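(* Let $F=F(N,\mathcal D)$ be a non-fragile connected GSC. Then $F$ has a cut point if and only if $\chi(\Gamma_k)\ge|\mathcal D|^{k-1}$ for all $k\ge2$. Moreover, if there exists $k_0\ge2$ such that $\chi(\Gamma_k)\ge|\mathcal D|^{k-1}$ for all $k\ge k_0$, then $F$ has a cut point.
   Context: GSC: $N\ge2$, $\mathcal D\subset\{0,\dots,N-1\}^2$ with $1<|\mathcal D|<N^2$, $\varphi_i(x)=\frac1N(x+i)$, $F$ the attractor $F=\bigcup_{i\in\mathcal D}\varphi_i(F)$; $\varphi_{i_1\cdots i_k}=\varphi_{i_1}\circ\cdots\circ\varphi_{i_k}$. $\Gamma_k$: vertex set $\mathcal D^k$, edge between distinct $\mathbf i,\mathbf j$ iff $\varphi_{\mathbf i}(F)\cap\varphi_{\mathbf j}(F)\ne\varnothing$. $\chi(G)$ for a connected graph $G$: max over cut vertices $v$ of the number of vertices of the second largest component of $G-\{v\}$ (0 if no cut vertex). A connected GSC $F$ is fragile if there is a partition $\mathcal D=\mathcal D_1\cup\mathcal D_2$ into disjoint nonempty sets such that $\big(\bigcup_{i\in\mathcal D_1}\varphi_i(F)\big)\cap\big(\bigcup_{i\in\mathcal D_2}\varphi_i(F)\big)$ is a singleton; non-fragile otherwise. *)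

theory Defs
  imports "HOL-Analysis.Analysis"
begin

definition gsc_map :: "nat \<Rightarrow> nat \<times> nat \<Rightarrow> real \<times> real \<Rightarrow> real \<times> real" where
  "gsc_map N i x = (1 / real N) *\<^sub>R (x + (real (fst i), real (snd i)))"

definition gsc_word_map :: "nat \<Rightarrow> (nat \<times> nat) list \<Rightarrow> real \<times> real \<Rightarrow> real \<times> real" where
  "gsc_word_map N w = foldr (\<lambda>i f. gsc_map N i \<circ> f) w id"

definition is_gsc :: "nat \<Rightarrow> (nat \<times> nat) set \<Rightarrow> bool" where
  "is_gsc N D \<longleftrightarrow> N \<ge> 2 \<and> D \<subseteq> {0..<N} \<times> {0..<N} \<and> 1 < card D \<and> card D < N ^ 2"

definition gsc_attractor :: "nat \<Rightarrow> (nat \<times> nat) set \<Rightarrow> (real \<times> real) set" where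
  "gsc_attractor N D =
     (THE F. compact F \<and> F \<noteq> {} \<and> F = (\<Union>i\<in>D. gsc_map N i ` F))"

definition gsc_words :: "(nat \<times> nat) set \<Rightarrow> nat \<Rightarrow> (nat \<times> nat) list set" where
  "gsc_words D k = {w. length w = k \<and> set w \<subseteq> D}"

definition gsc_adj :: "nat \<Rightarrow> (nat \<times> nat) set \<Rightarrow> (nat \<times> nat) list \<Rightarrow> (nat \<times> nat) list \<Rightarrow> bool" where
  "gsc_adj N D v w \<longleftrightarrow> v \<noteq> w \<and>
     gsc_word_map N v ` gsc_attractor N D \<inter> gsc_word_map N w ` gsc_attractor N D \<noteq> {}"

definition reach_in :: "'a set \<Rightarrow> ('a \<Rightarrow> 'a \<Rightarrow> bool) \<Rightarrow> 'a \<Rightarrow> 'a \<Rightarrow> bool" where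
  "reach_in W E = (\<lambda>x y. x \<in> W \<and> y \<in> W \<and> E x y)\<^sup>*\<^sup>*"

definition component_in :: "'a set \<Rightarrow> ('a \<Rightarrow> 'a \<Rightarrow> bool) \<Rightarrow> 'a \<Rightarrow> 'a set" where
  "component_in W E x = {y \<in> W. reach_in W E x y}"

definition components_in :: "'a set \<Rightarrow> ('a \<Rightarrow> 'a \<Rightarrow> bool) \<Rightarrow> 'a set set" where
  "components_in W E = component_in W E ` W"

definition graph_connected :: "'a set \<Rightarrow> ('a \<Rightarrow> 'a \<Rightarrow> bool) \<Rightarrow> bool" where
  "graph_connected V E \<longleftrightarrow> V \<noteq> {} \<and> (\<forall>x\<in>V. \<forall>y\<in>V. reach_in V E x y)"

definition cut_vertex :: "'a set \<Rightarrow> ('a \<Rightarrow> 'a \<Rightarrow> bool) \<Rightarrow> 'a \<Rightarrow> bool" where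
  "cut_vertex V E v \<longleftrightarrow> v \<in> V \<and> card (components_in (V - {v}) E) \<ge> 2"

text \<open>Number of vertices of the second largest component (counted with multiplicity):
  the largest value of min(|C1|,|C2|) over two distinct components C1, C2.\<close>
definition second_largest_comp :: "'a set \<Rightarrow> ('a \<Rightarrow> 'a \<Rightarrow> bool) \<Rightarrow> nat" where
  "second_largest_comp W E =
     Max {min (card C1) (card C2) | C1 C2.
            C1 \<in> components_in W E \<and> C2 \<in> components_in W E \<and> C1 \<noteq> C2}"

definition chi :: "'a set \<Rightarrow> ('a \<Rightarrow> 'a \<Rightarrow> bool) \<Rightarrow> nat" where
  "chi V E = (if \<exists>v. cut_vertex V E v
              then Max {second_largest_comp (V - {v}) E | v. cut_vertex V E v}
              else 0)"

definition Gamma_chi :: "nat \<Rightarrow> (nat \<times> nat) set \<Rightarrow> nat \<Rightarrow> nat" where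
  "Gamma_chi N D k = chi (gsc_words D k) (gsc_adj N D)"

definition fragile :: "nat \<Rightarrow> (nat \<times> nat) set \<Rightarrow> bool" where
  "fragile N D \<longleftrightarrow> connected (gsc_attractor N D) \<and>
     (\<exists>D1 D2. D1 \<noteq> {} \<and> D2 \<noteq> {} \<and> D1 \<inter> D2 = {} \<and> D1 \<union> D2 = D \<and>
        (\<exists>p. (\<Union>i\<in>D1. gsc_map N i ` gsc_attractor N D) \<inter>
             (\<Union>i\<in>D2. gsc_map N i ` gsc_attractor N D) = {p}))"

definition has_cut_point :: "(real \<times> real) set \<Rightarrow> bool" where
  "has_cut_point F \<longleftrightarrow> (\<exists>x\<in>F. \<not> connected (F - {x}))"

end

theory Submission
  imports Defs
begin

text \<open>Suppose first that \<open>\<chi>(\<Gamma>\<^sub>k)\<close> is large for all large \<open>k\<close>. The cells of the corresponding cut vertices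
  accumulate at a point \<open>x\<close>. If \<open>F - {x}\<close> were connected, any two cells avoiding \<open>x\<close> would be joined by a finite
  chain of such cells, which eventually misses the cut vertex; but at most four cells of level 4 contain \<open>x\<close>,
  so both large components contain descendants of cells avoiding \<open>x\<close>.

  Conversely, let \<open>x\<close> separate \<open>F\<close> into \<open>U\<close> and \<open>V\<close>. If \<open>F\<close> is not fragile, some first-level cell meets both
  sides, so pulling back to that cell yields a cut point again. In this way one reaches a cut point lying in
  only one cell of every level. If at some stage of pulling back along its address both sides contain a
  first-level cell, then the cell around the cut point is a cut vertex with two components of size at least
  \<open>card D ^ (k - 1)\<close>. Otherwise all first-level cells but one lie on the same side at each stage, and this
  side cannot be constant, since the other one would then shrink to a point. At a change of sides the contact set of the cell
  with the rest of \<open>F\<close> sits inside a single subcell. Contact sets have at least two points because \<open>F\<close> is not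
  fragile, and a study of how they scale shows that this is impossible.\<close>

section \<open>Contact sets contained in a single subcell\<close>

text \<open>Here \<open>E\<close> is the digit set and \<open>M\<close> the attractor. They are curried predicates, so that the symmetries of the
  square act by substitution. The point \<open>(p, q)\<close> is a contact of the cell \<open>i\<close> if its image in that cell also lies
  in another first-level cell.\<close>

definition contact :: "(int \<Rightarrow> int \<Rightarrow> bool) \<Rightarrow> (real \<Rightarrow> real \<Rightarrow> bool) \<Rightarrow> int \<Rightarrow> int \<Rightarrow> real \<Rightarrow> real \<Rightarrow> bool" where
  "contact E M i1 i2 p q \<longleftrightarrow> M p q \<and>
     (\<exists>a b. E a b \<and> (a, b) \<noteq> (i1, i2) \<and> M (p + of_int i1 - of_int a) (q + of_int i2 - of_int b))"

definition only_child :: "int \<Rightarrow> (int \<Rightarrow> int \<Rightarrow> bool) \<Rightarrow> (real \<Rightarrow> real \<Rightarrow> bool) \<Rightarrow> int \<Rightarrow> int \<Rightarrow> real \<Rightarrow> real \<Rightarrow> bool" where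
  "only_child n E M j1 j2 p q \<longleftrightarrow>
     (\<forall>a b. E a b \<and> M (of_int n * p - of_int a) (of_int n * q - of_int b) \<longrightarrow> a = j1 \<and> b = j2)"

text \<open>The configuration at a change of sides: the cell \<open>i\<close> meets the others only in its subcell \<open>j\<close>. The two
  alternatives of \<open>only_l\<close> are that the side changes again at the next digit \<open>l\<close>, or that it does not.\<close>

locale alternation =
  fixes n :: int and E :: "int \<Rightarrow> int \<Rightarrow> bool" and M :: "real \<Rightarrow> real \<Rightarrow> bool"
    and i1 i2 j1 j2 l1 l2 :: int
  assumes n2: "n \<ge> 2"
    and dig: "E a b \<Longrightarrow> 0 \<le> a \<and> a < n \<and> 0 \<le> b \<and> b < n"
    and unit: "M p q \<Longrightarrow> 0 \<le> p \<and> p \<le> 1 \<and> 0 \<le> q \<and> q \<le> 1"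
    and self_similar: "M p q \<longleftrightarrow> (\<exists>a b. E a b \<and> M (of_int n * p - of_int a) (of_int n * q - of_int b))"
    and fixed: "E a b \<Longrightarrow> M (of_int a / (of_int n - 1)) (of_int b / (of_int n - 1))"
    and two_i: "\<exists>p q p' q'. contact E M i1 i2 p q \<and> contact E M i1 i2 p' q' \<and> (p, q) \<noteq> (p', q')"
    and two_j: "\<exists>p q p' q'. contact E M j1 j2 p q \<and> contact E M j1 j2 p' q' \<and> (p, q) \<noteq> (p', q')"
    and only_j: "contact E M i1 i2 p q \<Longrightarrow> only_child n E M j1 j2 p q"
    and only_l: "(\<forall>p q. contact E M j1 j2 p q \<longrightarrow> only_child n E M l1 l2 p q) \<or>
       (\<forall>p q. contact E M i1 i2 ((p + of_int j1) / of_int n) ((q + of_int j2) / of_int n) \<longrightarrow> M p q \<longrightarrow>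
              only_child n E M l1 l2 p q)"
begin

section \<open>Symmetries of the square\<close>

lemma swap: "alternation n (\<lambda>a b. E b a) (\<lambda>p q. M q p) i2 i1 j2 j1 l2 l1"
proof -
  have c: "contact (\<lambda>a b. E b a) (\<lambda>p q. M q p) k2 k1 p q = contact E M k1 k2 q p" for k1 k2 p q
    unfolding contact_def by auto
  have o: "only_child n (\<lambda>a b. E b a) (\<lambda>p q. M q p) k2 k1 p q = only_child n E M k1 k2 q p" for k1 k2 p q
    unfolding only_child_def by auto
  show ?thesis
  proof (unfold_locales, unfold c o)
    show "M q p = (\<exists>a b. E b a \<and> M (of_int n * q - of_int b) (of_int n * p - of_int a))" for p q
      by (subst self_similar) auto
    show "\<exists>p q p' q'. contact E M i1 i2 q p \<and> contact E M i1 i2 q' p' \<and> (p, q) \<noteq> (p', q')"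
      using two_i by blast
    show "\<exists>p q p' q'. contact E M j1 j2 q p \<and> contact E M j1 j2 q' p' \<and> (p, q) \<noteq> (p', q')"
      using two_j by blast
  qed (use n2 dig unit fixed only_j only_l in blast)+
qed

text \<open>The reflection \<open>p \<mapsto> 1 - p\<close> acts on digits by
  \<open>a \<mapsto> n - 1 - a\<close>; \<open>ex\<close> and \<open>all\<close> reindex the
  quantifiers over digits accordingly. Together with \<open>swap\<close> it generates all symmetries
  of the square, so each later argument is carried out for one side or corner only.\<close>

lemma flip: "alternation n (\<lambda>a b. E (n - 1 - a) b) (\<lambda>p q. M (1 - p) q)
   (n - 1 - i1) i2 (n - 1 - j1) j2 (n - 1 - l1) l2"
proof -
  have ex: "(\<exists>a. P (n - 1 - a)) = (\<exists>a. P a)" for P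
  proof
    assume "\<exists>a. P a"
    then obtain a where "P a" by blast
    then show "\<exists>a. P (n - 1 - a)" by (intro exI[of _ "n - 1 - a"]) simp
  qed blast
  have all: "(\<forall>a. P (n - 1 - a)) = (\<forall>a. P a)" for P
    using ex[of "\<lambda>a. \<not> P a"] by blast
  have c: "contact (\<lambda>a b. E (n - 1 - a) b) (\<lambda>p q. M (1 - p) q) (n - 1 - k1) k2 p q = contact E M k1 k2 (1 - p) q" for k1 k2 p q
    unfolding contact_def
    by (subst (2) ex[symmetric]) (auto simp: algebra_simps)
  have o: "only_child n (\<lambda>a b. E (n - 1 - a) b) (\<lambda>p q. M (1 - p) q) (n - 1 - k1) k2 p q = only_child n E M k1 k2 (1 - p) q" for k1 k2 p q
    unfolding only_child_def
    by (subst (2) all[symmetric]) (auto simp: algebra_simps)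
  show ?thesis
  proof (unfold_locales, unfold c o)
    show "M (1 - p) q = (\<exists>a b. E (n - 1 - a) b \<and> M (1 - (of_int n * p - of_int a)) (of_int n * q - of_int b))" for p q
      by (subst self_similar, subst ex[symmetric]) (auto simp: algebra_simps)
    show "\<exists>p q p' q'. contact E M i1 i2 (1 - p) q \<and> contact E M i1 i2 (1 - p') q' \<and> (p, q) \<noteq> (p', q')"
    proof -
      obtain p q p' q' where "contact E M i1 i2 p q" "contact E M i1 i2 p' q'" "(p, q) \<noteq> (p', q')"
        using two_i by blast
      then show ?thesis
        by (intro exI[of _ "1 - p"] exI[of _ q] exI[of _ "1 - p'"] exI[of _ q']) auto
    qed
    show "\<exists>p q p' q'. contact E M j1 j2 (1 - p) q \<and> contact E M j1 j2 (1 - p') q' \<and> (p, q) \<noteq> (p', q')"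
    proof -
      obtain p q p' q' where "contact E M j1 j2 p q" "contact E M j1 j2 p' q'" "(p, q) \<noteq> (p', q')"
        using two_j by blast
      then show ?thesis
        by (intro exI[of _ "1 - p"] exI[of _ q] exI[of _ "1 - p'"] exI[of _ q']) auto
    qed
    show "M (1 - of_int a / (of_int n - 1)) (of_int b / (of_int n - 1))" if "E (n - 1 - a) b" for a b
    proof -
      have "1 - of_int a / (of_int n - 1) = (of_int (n - 1 - a) / (of_int n - 1) :: real)"
        using n2 by (simp add: field_simps)
      then show ?thesis using fixed[OF that] by simp
    qed
    show "(\<forall>p q. contact E M j1 j2 (1 - p) q \<longrightarrow> only_child n E M l1 l2 (1 - p) q) \<or>
     (\<forall>p q. contact E M i1 i2 (1 - (p + of_int (n - 1 - j1)) / of_int n) ((q + of_int j2) / of_int n) \<longrightarrow>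
         M (1 - p) q \<longrightarrow> only_child n E M l1 l2 (1 - p) q)"
    proof -
      have "1 - (p + of_int (n - 1 - j1)) / of_int n = ((1 - p) + of_int j1) / of_int n" for p :: real
        using n2 by (simp add: field_simps)
      then show ?thesis using only_l by presburger
    qed
    show "0 \<le> a \<and> a < n \<and> 0 \<le> b \<and> b < n" if "E (n - 1 - a) b" for a b
      using dig[OF that] by auto
    show "0 \<le> p \<and> p \<le> 1 \<and> 0 \<le> q \<and> q \<le> 1" if "M (1 - p) q" for p q
      using unit[OF that] by auto
  qed (use n2 only_j in auto)
qed

section \<open>Corners and sides of the unit square\<close>

lemma refine: "E a b \<Longrightarrow> M (of_int n * p - of_int a) (of_int n * q - of_int b) \<Longrightarrow> M p q"
  using self_similar by blast

text \<open>Only the cell of the digit \<open>(0, 0)\<close> reaches this corner, and the corner is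
  the fixed point of that digit. Reflections give the corners \<open>(1, 0)\<close> and
  \<open>(0, 1)\<close> below.\<close>

lemma corner00: "M 0 0 \<longleftrightarrow> E 0 0"
proof
  assume "M 0 0"
  then obtain a b where "E a b" "M (of_int n * 0 - of_int a) (of_int n * 0 - of_int b)" using self_similar by blast
  with dig[of a b] unit[OF this(2)] have "a = 0" "b = 0" by auto
  with \<open>E a b\<close> show "E 0 0" by simp
qed (use fixed[of 0 0] in simp)

end

lemmas (in alternation) corner10 = alternation.corner00[OF flip, simplified]
lemmas (in alternation) corner01 = alternation.corner10[OF swap, simplified]

context alternation begin

text \<open>The reflection \<open>q \<mapsto> 1 - q\<close>, as a conjugate of
  \<open>flip\<close>.\<close>

lemmas mirror = alternation.swap[OF alternation.flip[OF swap]]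

lemma left_cell:
  assumes "M 0 t"
  obtains b where "E 0 b" "M 0 (of_int n * t - of_int b)"
proof -
  obtain a b where ab: "E a b" "M (of_int n * 0 - of_int a) (of_int n * t - of_int b)"
    using assms self_similar by blast
  with dig[of a b] unit[OF this(2)] have "a = 0" by auto
  with ab that show ?thesis by auto
qed

end

lemma (in alternation) right_cell:
  assumes "M 1 t"
  obtains b where "E (n - 1) b" "M 1 (of_int n * t - of_int b)"
  using alternation.left_cell[OF flip, of t] assms by auto

context alternation begin

section \<open>Contacts with a horizontal neighbour\<close>

lemma refine_0: "E 0 b \<Longrightarrow> M 0 (of_int n * t - of_int b) \<Longrightarrow> M 0 t"
  using refine[of 0 b 0 t] by simp

lemma refine_1: "E (n - 1) b \<Longrightarrow> M 1 (of_int n * t - of_int b) \<Longrightarrow> M 1 t"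
  using refine[of "n - 1" b 1 t] by simp

text \<open>In the coordinates of the left neighbour, the point \<open>(0, t)\<close> of the cell
  \<open>i\<close> is \<open>(1, t)\<close>. Contacts with that neighbour are thus given by the
  heights \<open>t\<close> with \<open>M 0 t\<close> and \<open>M 1 t\<close>.\<close>

lemma contact_left: "E (i1 - 1) i2 \<Longrightarrow> M 0 t \<Longrightarrow> M 1 t \<Longrightarrow> contact E M i1 i2 0 t"
  unfolding contact_def by (intro conjI exI[of _ "i1 - 1"] exI[of _ i2]) auto

lemma only_left:
  assumes "E (i1 - 1) i2" "M 0 t" "M 1 t" "E 0 c" "M 0 (of_int n * t - of_int c)"
  shows "c = j2"
  using only_j[OF contact_left[OF assms(1-3)]] assms(4,5) unfolding only_child_def by force

text \<open>Every neighbour that \<open>j\<close> might have, apart from the one diagonally below it, would create a contact of \<open>i\<close>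
  outside of \<open>j\<close> or a contact of \<open>j\<close> outside of \<open>l\<close>; but that neighbour touches \<open>j\<close> in a single point.\<close>

lemma left_contact_no_corner:
  assumes left: "E (i1 - 1) i2" and j1: "j1 = 0" and b: "E 0 j2" "E (n - 1) j2"
    and b': "E (n - 1) (j2 + 1)" and M01: "M 0 1" and M10: "M 1 0"
  shows False
proof -
  have lt: "j2 + 1 < n" "j2 \<ge> 0" using dig[OF b'] dig[OF b(1)] by auto
  have n0: "real_of_int n \<noteq> 0" "real_of_int n - 1 \<noteq> 0" using n2 by auto
  \<comment> \<open>\<open>t\<close> is the common height of the fixed points of the digits
    \<open>(0, j2)\<close> and \<open>(n - 1, j2)\<close>. \<open>u\<close> is the top of row
    \<open>j2\<close>: there the upper left corner of the cell \<open>(0, j2)\<close> faces the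
    lower right corner of \<open>(n - 1, j2 + 1)\<close>. Both are heights of contacts with the left
    neighbour of \<open>i\<close>.\<close>
  define t where "t = (of_int j2 / (of_int n - 1) :: real)"
  define u where "u = ((of_int j2 + 1) / of_int n :: real)"
  have nt: "of_int n * t - of_int j2 = t" and nt': "(t + of_int j2) / of_int n = t"
    using n0 unfolding t_def by (simp_all add: field_simps)
  have nu: "of_int n * u = of_int j2 + 1" using n0 unfolding u_def by simp
  have t: "M 0 t" "M 1 t" using fixed[OF b(1)] fixed[OF b(2)] n0 unfolding t_def by auto
  have u: "M 0 u" "M 1 u" using refine_0[OF b(1), of u] refine_1[OF b', of u] nu M01 M10 by auto
  have E0: "E 0 (n - 1)" using corner01 M01 by simp
  have M11: "\<not> M 1 1"
  proof
    assume "M 1 1"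
    then have "n - 1 = j2" using only_left[OF left M01 _ E0] M01 by simp
    then show False using lt by simp
  qed
  from only_l show False
  proof
    assume only: "\<forall>p q. contact E M j1 j2 p q \<longrightarrow> only_child n E M l1 l2 p q"
    \<comment> \<open>Going through the possible neighbours of \<open>j\<close> leaves the one
      diagonally below as the only source of contacts; this contradicts
      \<open>two_j\<close>.\<close>
    have "p = 1 \<and> q = 0" if "contact E M j1 j2 p q" for p q
    proof -
      from that j1 obtain a c where ac: "E a c" "(a, c) \<noteq> (0, j2)" "M p q" "M (p - of_int a) (q + of_int j2 - of_int c)"
        unfolding contact_def by auto
      note un = unit[OF ac(3)] unit[OF ac(4)]
      have a: "a = 0 \<or> a = 1" using dig[OF ac(1)] un by linarith
      have c: "c = j2 \<or> c = j2 + 1 \<or> c = j2 - 1" using un by linarith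
      have "a \<noteq> 0"
      proof
        assume "a = 0"
        with ac(2) c consider "c = j2 + 1" | "c = j2 - 1" by auto
        then show False
        proof cases
          case 1
          \<comment> \<open>A neighbour directly above \<open>j\<close> would produce a contact of
            \<open>i\<close> at the height of its fixed point, which lies in that neighbour and not
            only in \<open>j\<close>.\<close>
          define s where "s = ((of_int j2 + 1) / (of_int n - 1) :: real)"
          have ns: "of_int n * s - of_int (j2 + 1) = s" using n0 unfolding s_def by (simp add: field_simps)
          have E: "E 0 (j2 + 1)" using ac(1) 1 \<open>a = 0\<close> by simp
          have "M 0 s" "M 1 s" using fixed[OF E] fixed[OF b'] n0 unfolding s_def by auto
          with only_left[OF left this E] ns show False by simp
        next
          case 2
          have E: "E 0 (j2 - 1)" using ac(1) 2 \<open>a = 0\<close> by simp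
          \<comment> \<open>A neighbour directly below \<open>j\<close> has its upper left corner at
            height \<open>j2 / n\<close>, and the lower right corner of the cell
            \<open>(n - 1, j2)\<close> has the same height. This is a contact of \<open>i\<close>
            lying in the wrong row.\<close>
          have "M 0 (of_int j2 / of_int n)" "M 1 (of_int j2 / of_int n)"
            using refine_0[OF E, of "of_int j2 / of_int n"] refine_1[OF b(2), of "of_int j2 / of_int n"] M01 M10 n0 by auto
          with only_left[OF left this E] M01 n0 show False by simp
        qed
      qed
      with a have a: "a = 1" by simp
      with un have p: "p = 1" by simp
      from c consider "c = j2" | "c = j2 + 1" | "c = j2 - 1" by blast
      then show ?thesis
      proof cases
        case 1
        have right: "only_child n E M l1 l2 1 s" if "M 0 s" "M 1 s" for s
        proof -
          have "contact E M j1 j2 1 s" unfolding contact_def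
            using that ac(1) a 1 j1 by (intro conjI exI[of _ 1] exI[of _ j2]) auto
          with only show ?thesis by blast
        qed
        \<comment> \<open>With a right neighbour, both \<open>(1, t)\<close> and
          \<open>(1, u)\<close> are contacts of \<open>j\<close>, but they lie in the cells of rows
          \<open>j2\<close> and \<open>j2 + 1\<close>, so \<open>l\<close> cannot serve
          both.\<close>
        have "l2 = j2" using right[OF t] b(2) t nt unfolding only_child_def by force
        moreover have "l2 = j2 + 1" using right[OF u] b' M10 nu unfolding only_child_def by force
        ultimately show ?thesis by simp
      next
        case 2
        with un have "q = 1" by simp
        with ac(3) p M11 show ?thesis by simp
      next
        case 3
        with un p show ?thesis by simp
      qed
    qed
    with two_j show False by blast
  next
    assume only: "\<forall>p q. contact E M i1 i2 ((p + of_int j1) / of_int n) ((q + of_int j2) / of_int n) \<longrightarrow>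
        M p q \<longrightarrow> only_child n E M l1 l2 p q"
    \<comment> \<open>Pulled back to \<open>j\<close>, the contacts at heights \<open>t\<close> and
      \<open>u\<close> become \<open>(0, t)\<close> and \<open>(0, 1)\<close>. They lie in the rows
      \<open>j2\<close> and \<open>n - 1\<close>, which differ.\<close>
    have "only_child n E M l1 l2 0 t"
      using only[rule_format, of 0 t] contact_left[OF left t] t nt' j1 by simp
    then have "l2 = j2" using b(1) t nt unfolding only_child_def by force
    moreover have "only_child n E M l1 l2 0 1"
      using only[rule_format, of 0 1] contact_left[OF left u] M01 j1 unfolding u_def by (simp add: add.commute)
    then have "l2 = n - 1" using E0 M01 unfolding only_child_def by force
    ultimately show False using lt by simp
  qed
qed

end

lemma (in alternation) left_contact_no_corner':
  assumes "E (i1 - 1) i2" "j1 = 0" "E 0 j2" "E (n - 1) j2" "E (n - 1) (j2 - 1)" "M 0 0" "M 1 1"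
  shows False
  using alternation.left_contact_no_corner[OF mirror] assms by (simp add: algebra_simps)

context alternation begin

text \<open>At a contact height \<open>u\<close>, the point \<open>(0, u)\<close> lies in the cell
  \<open>j\<close>, while \<open>(1, u)\<close> lies in the last column in row \<open>j2\<close> or
  an adjacent row. In row \<open>j2\<close> the height \<open>n * u - j2\<close> is again one of a
  contact, and this expansion cannot go on forever when there are two heights. An adjacent row fixes
  \<open>u\<close> and brings in the corners excluded by \<open>left_contact_no_corner\<close> and
  its mirror image.\<close>

lemma left_contact_unique_aux:
  assumes left: "E (i1 - 1) i2" and s: "M 0 s" "M 1 s" and t: "M 0 t" "M 1 t" and "s < t"
  shows False
proof -
  have j: "j1 = 0 \<and> E 0 j2 \<and> M 0 (of_int n * u - of_int j2)" if u: "M 0 u" "M 1 u" for u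
  proof -
    obtain b where b: "E 0 b" "M 0 (of_int n * u - of_int b)" using left_cell u by blast
    with only_j[OF contact_left[OF left u]] show ?thesis unfolding only_child_def by force
  qed
  have j1: "j1 = 0" and Ej: "E 0 j2" using j s by blast+
  \<comment> \<open>\<open>A\<close> belongs to \<open>u\<close> at the top of row
    \<open>j2\<close>, with \<open>(1, u)\<close> one row higher; \<open>B\<close> belongs to
    \<open>u\<close> at the bottom, with \<open>(1, u)\<close> one row lower.\<close>
  define A where "A \<longleftrightarrow> M 0 1 \<and> M 1 0 \<and> E (n - 1) (j2 + 1)"
  define B where "B \<longleftrightarrow> M 0 0 \<and> M 1 1 \<and> E (n - 1) (j2 - 1)"
  have cases: "(A \<and> of_int n * u = of_int j2 + 1) \<or> (B \<and> of_int n * u = of_int j2) \<or>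
      (E (n - 1) j2 \<and> M 1 (of_int n * u - of_int j2))"
    if u: "M 0 u" "M 1 u" for u
  proof -
    from j[OF u] have M0: "M 0 (of_int n * u - of_int j2)" by simp
    obtain b' where b': "E (n - 1) b'" "M 1 (of_int n * u - of_int b')" using right_cell u by blast
    note un = unit[OF M0] unit[OF b'(2)]
    from un have "b' = j2 \<or> b' = j2 + 1 \<or> b' = j2 - 1" by linarith
    then consider "b' = j2" | "b' = j2 + 1" | "b' = j2 - 1" by blast
    then show ?thesis
    proof cases
      case 1 with b' show ?thesis by simp
    next
      case 2
      then have "of_int n * u = of_int j2 + 1" using un by simp
      with M0 b' 2 show ?thesis unfolding A_def by simp
    next
      case 3
      then have "of_int n * u = of_int j2" using un by simp
      with M0 b' 3 show ?thesis unfolding B_def by simp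
    qed
  qed
  have "\<not> (A \<and> B)"
  proof
    assume AB: "A \<and> B"
    then have "E 0 0" "E 0 (n - 1)" using corner00 corner01 unfolding A_def B_def by auto
    with only_left[OF left _ _ this(1), of 0] only_left[OF left _ _ this(2), of 1] AB n2
    show False unfolding A_def B_def by simp
  qed
  moreover have "A \<or> B"
  proof (rule ccontr)
    assume "\<not> (A \<or> B)"
    \<comment> \<open>The contact set is then mapped into itself by an expansion.\<close>
    with cases j have step: "M 0 (of_int n * u - of_int j2) \<and> M 1 (of_int n * u - of_int j2)"
      if "M 0 u" "M 1 u" for u using that by blast
    have grow: "\<exists>s' t'. M 0 s' \<and> M 1 s' \<and> M 0 t' \<and> M 1 t' \<and> t' - s' = of_int n ^ k * (t - s)" for k
    proof (induction k)
      case 0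
      show ?case using s t by (intro exI[of _ s] exI[of _ t]) simp
    next
      case (Suc k)
      then obtain s' t' where st: "M 0 s'" "M 1 s'" "M 0 t'" "M 1 t'" "t' - s' = of_int n ^ k * (t - s)" by blast
      have "(of_int n * t' - of_int j2) - (of_int n * s' - of_int j2) = of_int n * (t' - s')"
        by (simp add: algebra_simps)
      with st(5) have "(of_int n * t' - of_int j2) - (of_int n * s' - of_int j2) = of_int n ^ Suc k * (t - s)"
        by simp
      with step[OF st(1,2)] step[OF st(3,4)] show ?case by blast
    qed
    obtain k where k: "1 / (t - s) < real_of_int n ^ k" using real_arch_pow[of "real_of_int n" "1 / (t - s)"] n2 by auto
    obtain s' t' where st: "M 0 s'" "M 0 t'" "t' - s' = of_int n ^ k * (t - s)" using grow by blast
    from k \<open>s < t\<close> have "1 < of_int n ^ k * (t - s)" by (simp add: field_simps)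
    with st unit[OF st(1)] unit[OF st(2)] show False by linarith
  qed
  \<comment> \<open>Otherwise every contact has the one exceptional height belonging to
    \<open>A\<close> or to \<open>B\<close>, so \<open>s = t\<close>.\<close>
  moreover have "E (n - 1) j2" if "\<not> (A \<and> B)"
  proof (rule ccontr)
    assume "\<not> E (n - 1) j2"
    with cases[OF s] cases[OF t] that have "of_int n * s = of_int n * t" by metis
    with n2 \<open>s < t\<close> show False by simp
  qed
  ultimately show False
    using left_contact_no_corner[OF left j1 Ej] left_contact_no_corner'[OF left j1 Ej]
    unfolding A_def B_def by blast
qed

lemma left_contact_unique:
  "E (i1 - 1) i2 \<Longrightarrow> M 0 s \<Longrightarrow> M 1 s \<Longrightarrow> M 0 t \<Longrightarrow> M 1 t \<Longrightarrow> s = t"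
  using left_contact_unique_aux[of s t] left_contact_unique_aux[of t s] by (meson linorder_neqE)

end

lemma (in alternation) right_contact_unique:
  "E (i1 + 1) i2 \<Longrightarrow> M 0 s \<Longrightarrow> M 1 s \<Longrightarrow> M 0 t \<Longrightarrow> M 1 t \<Longrightarrow> s = t"
  using alternation.left_contact_unique[OF flip, of s t] by (simp add: algebra_simps)

context alternation begin

section \<open>The position of the subcell j\<close>

lemma contact_cell:
  assumes "contact E M i1 i2 p q"
  shows "E j1 j2" "M (of_int n * p - of_int j1) (of_int n * q - of_int j2)"
proof -
  have "M p q" using assms unfolding contact_def by blast
  then obtain a b where "E a b" "M (of_int n * p - of_int a) (of_int n * q - of_int b)" using self_similar by blast
  with only_j[OF assms] show "E j1 j2" "M (of_int n * p - of_int j1) (of_int n * q - of_int j2)"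
    unfolding only_child_def by blast+
qed

text \<open>In an inner row the contacts satisfy \<open>0 < q < 1\<close>, so they come from the
  left or the right neighbour. The column \<open>j1\<close> allows only one of these, and uniqueness
  of the height contradicts \<open>two_i\<close>.\<close>

lemma not_inner:
  assumes "0 < j2" "j2 < n - 1"
  shows False
proof -
  have side: "(p = 0 \<and> j1 = 0 \<and> E (i1 - 1) i2 \<and> M 0 q \<and> M 1 q) \<or> (p = 1 \<and> j1 = n - 1 \<and> E (i1 + 1) i2 \<and> M 0 q \<and> M 1 q)"
    if c: "contact E M i1 i2 p q" for p q
  proof -
    from c obtain a b where ab: "E a b" "(a, b) \<noteq> (i1, i2)" "M p q" "M (p + of_int i1 - of_int a) (q + of_int i2 - of_int b)"
      unfolding contact_def by auto
    note un = unit[OF ab(3)] unit[OF ab(4)] unit[OF contact_cell(2)[OF c]]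
    have j2: "real_of_int j2 > 0" "real_of_int j2 < real_of_int n - 1" using assms by linarith+
    have "0 < of_int n * q" using un j2 by linarith
    then have q0: "0 < q" using n2 by (simp add: zero_less_mult_iff)
    have "of_int n * q < of_int n" using un j2 by linarith
    then have q1: "q < 1" using n2 by simp
    have b: "b = i2" using un q0 q1 by linarith
    with ab(2) un have "a = i1 - 1 \<or> a = i1 + 1" by auto
    then show ?thesis
    proof
      assume a: "a = i1 - 1"
      with un have p: "p = 0" by simp
      with un dig[OF contact_cell(1)[OF c]] have "j1 = 0" by simp
      with a b p ab show ?thesis by simp
    next
      assume a: "a = i1 + 1"
      with un have p: "p = 1" by simp
      with un dig[OF contact_cell(1)[OF c]] have "j1 = n - 1" by auto
      with a b p ab show ?thesis by simp
    qed
  qed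
  obtain p q p' q' where c: "contact E M i1 i2 p q" "contact E M i1 i2 p' q'" "(p, q) \<noteq> (p', q')"
    using two_i by blast
  from side[OF c(1)] side[OF c(2)] c(3) n2 left_contact_unique[of q q'] right_contact_unique[of q q']
  show False by auto
qed

text \<open>The digit \<open>(0, 0)\<close> gives \<open>M 0 0\<close>, and the last column yields
  \<open>M 1 0\<close>: the point \<open>(1, q)\<close> lies in its lowest cell or at the lower
  corner of the next one. So height 0 is a contact, and uniqueness applies.\<close>

lemma corner_contact_left:
  assumes j: "j2 = 0" and left: "E (i1 - 1) i2" and q: "M 0 q" "M 1 q"
  shows "q = 0"
proof -
  note c = contact_cell[OF contact_left[OF left q]]
  have j1: "j1 = 0" using c(2) unit[OF c(2)] dig[OF c(1)] by simp
  obtain b where b: "E (n - 1) b" "M 1 (of_int n * q - of_int b)" using right_cell q by blast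
  note un = unit[OF c(2)] unit[OF b(2)]
  have "b = 0 \<or> b = 1" using un dig[OF b(1)] j by linarith
  then have "M 1 0"
  proof
    assume "b = 0"
    then show ?thesis using b corner10 by simp
  next
    assume "b = 1"
    with un j have "of_int n * q = 1" by simp
    with b \<open>b = 1\<close> show ?thesis by simp
  qed
  moreover have "M 0 0" using c(1) j j1 corner00 by simp
  ultimately show ?thesis using left_contact_unique[OF left] q by blast
qed

end

lemma (in alternation) corner_contact_below:
  assumes "j1 = 0" "E i1 (i2 - 1)" "M q 0" "M q 1"
  shows "q = 0"
  using alternation.corner_contact_left[OF swap] assms by blast

context alternation begin

text \<open>Contacts in the subcell \<open>(0, 0)\<close> have both coordinates below 1, so only the
  neighbours to the left, below and diagonally below on the left matter. Each of them allows only
  the contact \<open>(0, 0)\<close>.\<close>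

lemma not_corner00: "\<not> (j1 = 0 \<and> j2 = 0)"
proof
  assume j: "j1 = 0 \<and> j2 = 0"
  have "p = 0 \<and> q = 0" if c: "contact E M i1 i2 p q" for p q
  proof -
    from c obtain a b where ab: "E a b" "(a, b) \<noteq> (i1, i2)" "M p q" "M (p + of_int i1 - of_int a) (q + of_int i2 - of_int b)"
      unfolding contact_def by auto
    note un = unit[OF ab(3)] unit[OF ab(4)] unit[OF contact_cell(2)[OF c]]
    have "p \<le> 1 / of_int n" "q \<le> 1 / of_int n" using un j n2 by (simp_all add: field_simps)
    moreover have "1 / of_int n < (1 :: real)" using n2 by simp
    ultimately have "p < 1" "q < 1" by linarith+
    with un have "a = i1 \<or> a = i1 - 1" "b = i2 \<or> b = i2 - 1" by linarith+
    with ab(2) consider "a = i1 - 1" "b = i2" | "a = i1" "b = i2 - 1" | "a = i1 - 1" "b = i2 - 1" by blast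
    then show ?thesis
    proof cases
      case 1
      then have "p = 0" using un by simp
      with ab 1 j corner_contact_left[of q] show ?thesis by simp
    next
      case 2
      then have "q = 0" using un by simp
      with ab 2 j corner_contact_below[of p] show ?thesis by simp
    next
      case 3
      then show ?thesis using un by simp
    qed
  qed
  with two_i show False by blast
qed

end

theorem (in alternation) inconsistent: False
proof -
  obtain p q where "contact E M i1 i2 p q" using two_i by blast
  note d = dig[OF contact_cell(1)[OF this]]
  have "j2 = 0 \<or> j2 = n - 1" using not_inner d by force
  moreover have "j1 = 0 \<or> j1 = n - 1" using alternation.not_inner[OF swap] d by force
  ultimately show False
    using not_corner00 alternation.not_corner00[OF flip] alternation.not_corner00[OF mirror]
      alternation.not_corner00[OF alternation.flip[OF mirror]]
    by auto
qed

section \<open>The attractor and its cells\<close>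

lemma dist_gsc_map: "dist (gsc_map N i x) (gsc_map N i y) = dist x y / real N"
proof -
  have "dist (gsc_map N i x) (gsc_map N i y) = norm ((1 / real N) *\<^sub>R (x - y))"
    unfolding gsc_map_def dist_norm by (simp flip: scaleR_diff_right)
  then show ?thesis by (simp add: dist_norm)
qed

lemma continuous_on_gsc_map: "continuous_on S (gsc_map N i)"
  unfolding gsc_map_def by (intro continuous_intros)

lemma gsc_map_fixed:
  assumes "N \<ge> 2"
  shows "gsc_map N i (real (fst i) / (real N - 1), real (snd i) / (real N - 1)) =
    (real (fst i) / (real N - 1), real (snd i) / (real N - 1))"
  using assms unfolding gsc_map_def by (simp add: field_simps)

lemma gsc_map_unit:
  assumes "N \<ge> 2" "fst i < N" "snd i < N" "x \<in> cbox (0, 0) (1, 1)"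
  shows "gsc_map N i x \<in> cbox (0, 0) (1, 1)"
proof -
  have "real (fst i) + 1 \<le> real N" "real (snd i) + 1 \<le> real N" using assms by linarith+
  with assms show ?thesis
    unfolding gsc_map_def by (cases x) (auto simp: field_simps simp flip: cbox_Pair_eq)
qed

text \<open>At a point \<open>g\<close> of \<open>G\<close> farthest from \<open>F\<close>, write
  \<open>g\<close> as the image of some \<open>h\<close> in \<open>G\<close>. Since the maps
  contract by \<open>N\<close>, the maximal distance is at most itself divided by \<open>N\<close>,
  hence 0. Inclusions suffice, so the lemma also applies to single fixed points.\<close>

lemma invariant_compact_subset:
  assumes N: "N \<ge> 2"
    and F: "compact F" "F \<noteq> {}" "(\<Union>i\<in>D. gsc_map N i ` F) \<subseteq> F"
    and G: "compact G" "G \<subseteq> (\<Union>i\<in>D. gsc_map N i ` G)"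
  shows "G \<subseteq> F"
proof (cases "G = {}")
  case False
  have "continuous_on G (\<lambda>g. infdist g F)" by (intro continuous_intros)
  then obtain g where g: "g \<in> G" "\<And>h. h \<in> G \<Longrightarrow> infdist h F \<le> infdist g F"
    using continuous_attains_sup[OF G(1) False] by blast
  obtain i h where ih: "i \<in> D" "h \<in> G" "g = gsc_map N i h" using g(1) G(2) by blast
  obtain f where f: "f \<in> F" "infdist h F = dist h f"
    using infdist_attains_inf[of F h] F compact_imp_closed by blast
  have "infdist g F \<le> dist g (gsc_map N i f)"
    using F(3) f(1) ih(1) by (intro infdist_le) blast
  also have "\<dots> = infdist h F / real N" using f ih dist_gsc_map by simp
  also have "\<dots> \<le> infdist g F / real N" using g(2)[OF ih(2)] by (simp add: divide_right_mono)
  finally have "infdist g F * real N \<le> infdist g F" using N by (simp add: field_simps)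
  moreover have "infdist g F * 2 \<le> infdist g F * real N" using N infdist_nonneg[of g F]
    by (intro mult_left_mono) auto
  ultimately have "infdist g F \<le> 0" by linarith
  with g(2) have "infdist h F = 0" if "h \<in> G" for h
    using that infdist_nonneg[of h F] by (meson order_antisym order_trans)
  then show ?thesis using in_closed_iff_infdist_zero[OF compact_imp_closed[OF F(1)] F(2)] by blast
qed simp

lemma compact_UN_gsc_map:
  assumes "finite D" "compact G"
  shows "compact (\<Union>i\<in>D. gsc_map N i ` G)"
  using assms by (intro compact_UN compact_continuous_image continuous_on_gsc_map)

lemma is_gsc_finite: "is_gsc N D \<Longrightarrow> finite D"
  unfolding is_gsc_def by (meson finite_SigmaI finite_atLeastLessThan finite_subset)

text \<open>The set is obtained as the greatest fixed point of the Hutchinson operator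
  \<open>T\<close> on subsets of the unit square. Its closure satisfies the same inclusion and is
  absorbed by maximality; a fixed point of any digit map shows that it is nonempty.\<close>

lemma ex_invariant_compact:
  assumes "is_gsc N D"
  shows "\<exists>F. compact F \<and> F \<noteq> {} \<and> F \<subseteq> cbox (0, 0) (1, 1) \<and> F = (\<Union>i\<in>D. gsc_map N i ` F)"
proof -
  have D: "fst i < N" "snd i < N" if "i \<in> D" for i
    using assms that unfolding is_gsc_def by auto
  have N: "N \<ge> 2" using assms unfolding is_gsc_def by auto
  define T where "T G = (\<Union>i\<in>D. gsc_map N i ` G)" for G
  define Q where "Q = cbox (0 :: real, 0 :: real) (1, 1)"
  define F where "F = \<Union>{G. G \<subseteq> Q \<and> G \<subseteq> T G}"
  have mono: "T G \<subseteq> T H" if "G \<subseteq> H" for G H using that unfolding T_def by blast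
  have TQ: "T G \<subseteq> Q" if "G \<subseteq> Q" for G
    using that gsc_map_unit[OF N D] unfolding T_def Q_def by blast
  have coind: "G \<subseteq> F" if "G \<subseteq> Q" "G \<subseteq> T G" for G using that unfolding F_def by blast
  have FQ: "F \<subseteq> Q" unfolding F_def by blast
  have FT: "F \<subseteq> T F"
  proof
    fix x assume "x \<in> F"
    then obtain G where G: "x \<in> G" "G \<subseteq> Q" "G \<subseteq> T G" unfolding F_def by blast
    then show "x \<in> T F" using mono[OF coind[OF G(2,3)]] by blast
  qed
  have "F = T F" using FT coind[OF TQ[OF FQ] mono[OF FT]] by blast
  moreover have "closed F"
  proof -
    have Q: "closure F \<subseteq> Q" using FQ unfolding Q_def by (simp add: closure_minimal closed_cbox)
    then have "compact (closure F)"
      by (metis Q_def bounded_cbox bounded_subset closed_closure compact_eq_bounded_closed)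
    then have "closed (T (closure F))"
      unfolding T_def using is_gsc_finite[OF assms] by (intro compact_imp_closed compact_UN_gsc_map)
    then have "closure F \<subseteq> T (closure F)"
      using FT mono[OF closure_subset[of F]] by (meson closure_minimal subset_trans)
    then show ?thesis using coind[OF Q] closure_subset_eq by blast
  qed
  then have "compact F" using FQ unfolding Q_def
    by (meson bounded_cbox bounded_subset compact_eq_bounded_closed)
  moreover have "F \<noteq> {}"
  proof -
    obtain i where i: "i \<in> D" using assms unfolding is_gsc_def by (metis card.empty ex_in_conv not_one_less_zero)
    define p where "p = (real (fst i) / (real N - 1), real (snd i) / (real N - 1))"
    have "gsc_map N i p = p" unfolding p_def by (rule gsc_map_fixed[OF N])
    then have "{p} \<subseteq> T {p}" using i unfolding T_def by simp metis
    moreover have "p \<in> Q"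
    proof -
      have "real (fst i) \<le> real N - 1" "real (snd i) \<le> real N - 1" using D[OF i] by linarith+
      then show ?thesis using N unfolding Q_def p_def by (auto simp: field_simps simp flip: cbox_Pair_eq)
    qed
    ultimately show ?thesis using coind[of "{p}"] by blast
  qed
  ultimately show ?thesis using FQ unfolding T_def Q_def by blast
qed

lemma gsc_attractor_works:
  assumes "is_gsc N D"
  shows "compact (gsc_attractor N D) \<and> gsc_attractor N D \<noteq> {} \<and> gsc_attractor N D \<subseteq> cbox (0, 0) (1, 1) \<and>
    gsc_attractor N D = (\<Union>i\<in>D. gsc_map N i ` gsc_attractor N D)"
proof -
  have N: "N \<ge> 2" using assms unfolding is_gsc_def by auto
  obtain F where F: "compact F" "F \<noteq> {}" "F \<subseteq> cbox (0, 0) (1, 1)" "F = (\<Union>i\<in>D. gsc_map N i ` F)"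
    using ex_invariant_compact[OF assms] by blast
  have "gsc_attractor N D = F"
    unfolding gsc_attractor_def
  proof (rule the_equality)
    fix G assume G: "compact G \<and> G \<noteq> {} \<and> G = (\<Union>i\<in>D. gsc_map N i ` G)"
    show "G = F"
      using invariant_compact_subset[OF N F(1,2) _ _, of D G] invariant_compact_subset[OF N _ _ _ F(1), of G D] F G
      by (metis order_refl subset_antisym)
  qed (use F in blast)
  then show ?thesis using F by blast
qed

section \<open>Reachability in graphs\<close>

lemma reach_refl: "reach_in X R x x" unfolding reach_in_def by simp
lemma reach_step: "x \<in> X \<Longrightarrow> y \<in> X \<Longrightarrow> R x y \<Longrightarrow> reach_in X R x y" unfolding reach_in_def by auto
lemma reach_trans: "reach_in X R x y \<Longrightarrow> reach_in X R y z \<Longrightarrow> reach_in X R x z"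
  unfolding reach_in_def by (rule rtranclp_trans)
lemma reach_sym: assumes "\<And>x y. R x y \<Longrightarrow> R y x" "reach_in X R x y" shows "reach_in X R y x"
  using assms(2) unfolding reach_in_def
proof (induction rule: rtranclp_induct)
  case (step y z)
  then have "(\<lambda>x y. x \<in> X \<and> y \<in> X \<and> R x y) z y" using assms(1) by blast
  then show ?case using step.IH by (rule converse_rtranclp_into_rtranclp)
qed simp
lemma reach_invariant:
  assumes "reach_in X R x y" "x \<in> A" "\<And>u v. u \<in> X \<Longrightarrow> v \<in> X \<Longrightarrow> R u v \<Longrightarrow> u \<in> A \<Longrightarrow> v \<in> A"
  shows "y \<in> A"
  using assms(1) unfolding reach_in_def by (induction rule: rtranclp_induct) (use assms in auto)

text \<open>The most significant digit comes first, as the first letter of a word gives the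
  outermost map. Applied to both coordinates of a word, this is the lower left grid corner of its
  cell, in units of \<open>1 / N ^ length w\<close>.\<close>

fun radix_value :: "nat \<Rightarrow> nat list \<Rightarrow> nat" where
  "radix_value N [] = 0"
| "radix_value N (d # ds) = radix_value N ds + N ^ length ds * d"

lemma radix_value_less: "\<forall>d\<in>set ds. d < N \<Longrightarrow> radix_value N ds < N ^ length ds"
proof (induction ds)
  case (Cons d ds)
  then have "radix_value N (d # ds) < N ^ length ds * (d + 1)" by simp
  also have "\<dots> \<le> N ^ length ds * N" using Cons.prems by (intro mult_le_mono) auto
  finally show ?case by (simp add: mult.commute)
qed simp

lemma radix_value_inj:
  "length ds = length es \<Longrightarrow> \<forall>d\<in>set ds. d < N \<Longrightarrow> \<forall>d\<in>set es. d < N \<Longrightarrow>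
    radix_value N ds = radix_value N es \<Longrightarrow> ds = es"
proof (induction ds es rule: list_induct2)
  case (Cons d ds e es)
  have less: "radix_value N ds < N ^ length ds" "radix_value N es < N ^ length ds"
    using radix_value_less[of ds N] radix_value_less[of es N] Cons by auto
  have eq: "radix_value N ds + N ^ length ds * d = radix_value N es + N ^ length ds * e"
    using Cons by simp
  then have "(radix_value N ds + N ^ length ds * d) div N ^ length ds =
      (radix_value N es + N ^ length ds * e) div N ^ length ds" by simp
  moreover have "N ^ length ds \<noteq> 0" using less by linarith
  ultimately have "d = e" using less by simp
  with eq Cons show ?case by simp
qed simp

section \<open>Words and cells of a connected attractor\<close>

locale connected_gsc =
  fixes N :: nat and D :: "(nat \<times> nat) set"
  assumes gsc: "is_gsc N D" and conn: "connected (gsc_attractor N D)"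
begin

abbreviation "F \<equiv> gsc_attractor N D"
abbreviation "\<phi> \<equiv> gsc_map N"
abbreviation "\<Phi> \<equiv> gsc_word_map N"
abbreviation "W k \<equiv> gsc_words D k"
abbreviation "cell w \<equiv> \<Phi> w ` F"

lemma N2: "N \<ge> 2" using gsc unfolding is_gsc_def by auto
lemma digits: "i \<in> D \<Longrightarrow> fst i < N \<and> snd i < N" using gsc unfolding is_gsc_def by auto
lemma finite_D: "finite D" using is_gsc_finite[OF gsc] .
lemma card_D: "card D \<ge> 2" using gsc unfolding is_gsc_def by auto
lemma compact_F: "compact F" using gsc_attractor_works[OF gsc] by (elim conjE)
lemma F_nonempty: "F \<noteq> {}" using gsc_attractor_works[OF gsc] by (elim conjE)
lemma F_unit: "F \<subseteq> cbox (0, 0) (1, 1)" using gsc_attractor_works[OF gsc] by (elim conjE)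
lemma F_eq: "F = (\<Union>i\<in>D. \<phi> i ` F)"
  using gsc_attractor_works[OF gsc] by (elim conjE)

lemma phi_in_F: "i \<in> D \<Longrightarrow> x \<in> F \<Longrightarrow> \<phi> i x \<in> F"
  by (subst F_eq) blast

lemma ex_digit: "x \<in> F \<Longrightarrow> \<exists>i\<in>D. \<exists>y\<in>F. x = \<phi> i y"
  by (subst (asm) F_eq) blast

lemma Phi_Nil [simp]: "\<Phi> [] x = x" unfolding gsc_word_map_def by simp
lemma Phi_Cons [simp]: "\<Phi> (i # w) x = \<phi> i (\<Phi> w x)" unfolding gsc_word_map_def by simp
lemma Phi_append: "\<Phi> (v @ w) x = \<Phi> v (\<Phi> w x)" by (induction v) auto

lemma dist_Phi: "dist (\<Phi> w x) (\<Phi> w y) = dist x y / real N ^ length w"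
  by (induction w) (auto simp: dist_gsc_map)

lemma Phi_inj: "\<Phi> w x = \<Phi> w y \<longleftrightarrow> x = y"
proof
  assume "\<Phi> w x = \<Phi> w y"
  then have "dist x y / real N ^ length w = 0" using dist_Phi[of w x y] by simp
  then show "x = y" using N2 by simp
qed simp

lemma continuous_on_Phi: "continuous_on S (\<Phi> w)"
proof (induction w)
  case Nil
  have "\<Phi> [] = (\<lambda>x. x)" by auto
  then show ?case by (simp add: continuous_on_id)
next
  case (Cons i w)
  have "\<Phi> (i # w) = (\<lambda>x. \<phi> i (\<Phi> w x))" by auto
  with continuous_on_compose2[OF continuous_on_gsc_map[of UNIV N i] Cons] show ?case by simp
qed

lemma words_Nil [simp]: "w \<in> W 0 \<longleftrightarrow> w = []" unfolding gsc_words_def by auto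
lemma words_Cons [simp]: "i # w \<in> W (Suc k) \<longleftrightarrow> i \<in> D \<and> w \<in> W k" unfolding gsc_words_def by auto
lemma words_append: "v \<in> W j \<Longrightarrow> w \<in> W k \<Longrightarrow> v @ w \<in> W (j + k)" unfolding gsc_words_def by auto
lemma words_length: "w \<in> W k \<Longrightarrow> length w = k" unfolding gsc_words_def by auto
lemma words_take: "w \<in> W (j + k) \<Longrightarrow> take j w \<in> W j"
  unfolding gsc_words_def using set_take_subset by fastforce
lemma words_drop: "w \<in> W (j + k) \<Longrightarrow> drop j w \<in> W k"
  unfolding gsc_words_def using set_drop_subset by fastforce

lemma finite_words: "finite (W k)" and card_words: "card (W k) = card D ^ k"
proof -
  have "W k = {w. set w \<subseteq> D \<and> length w = k}" unfolding gsc_words_def by auto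
  then show "finite (W k)" "card (W k) = card D ^ k"
    using finite_lists_length_eq[OF finite_D] card_lists_length_eq[OF finite_D] by auto
qed

lemma Phi_in_F: "w \<in> W k \<Longrightarrow> x \<in> F \<Longrightarrow> \<Phi> w x \<in> F"
proof (induction w arbitrary: k)
  case (Cons i w)
  then obtain k' where "k = Suc k'" "i \<in> D" "w \<in> W k'" unfolding gsc_words_def by auto
  with Cons have "\<Phi> w x \<in> F" "i \<in> D" by auto
  then show ?case using phi_in_F by simp
qed simp

lemma ex_word: "x \<in> F \<Longrightarrow> \<exists>w\<in>W k. \<exists>y\<in>F. x = \<Phi> w y"
proof (induction k arbitrary: x)
  case (Suc k)
  obtain i y where i: "i \<in> D" "y \<in> F" "x = \<phi> i y" using ex_digit[OF Suc.prems] by blast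
  obtain w z where "w \<in> W k" "z \<in> F" "y = \<Phi> w z" using Suc.IH i by blast
  with i show ?case by (intro bexI[of _ "i # w"] bexI[of _ z]) simp_all
qed simp

lemma words_nonempty: "W k \<noteq> {}" using ex_word F_nonempty by blast

lemma F_Union_cells: "F = (\<Union>w\<in>W k. cell w)"
proof
  show "F \<subseteq> (\<Union>w\<in>W k. cell w)" using ex_word by blast
  show "(\<Union>w\<in>W k. cell w) \<subseteq> F" using Phi_in_F by blast
qed

lemma compact_cell: "compact (cell w)"
  by (intro compact_continuous_image continuous_on_Phi compact_F)

lemma closed_cells: "closed (\<Union>w\<in>A. cell w)" if "A \<subseteq> W k" for A
  using that finite_words finite_subset compact_cell
  by (intro closed_UN) (auto intro: compact_imp_closed)

lemma connected_cell: "connected (cell w)"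
  by (intro connected_continuous_image continuous_on_Phi conn)

lemma dist_F: "x \<in> F \<Longrightarrow> y \<in> F \<Longrightarrow> dist x y \<le> 2"
proof -
  assume "x \<in> F" "y \<in> F"
  then have "x \<in> cbox (0, 0) (1, 1)" "y \<in> cbox (0, 0) (1, 1)" using F_unit by auto
  then have "\<bar>fst x - fst y\<bar> \<le> 1" "\<bar>snd x - snd y\<bar> \<le> 1"
    by (cases x; cases y; auto simp flip: cbox_Pair_eq)+
  then show ?thesis
    unfolding dist_prod_def dist_real_def using sqrt_sum_squares_le_sum_abs[of "fst x - fst y" "snd x - snd y"]
    by simp
qed

lemma dist_cell: "w \<in> W k \<Longrightarrow> x \<in> cell w \<Longrightarrow> y \<in> cell w \<Longrightarrow> dist x y \<le> 2 / real N ^ k"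
  using dist_F dist_Phi words_length by (auto intro!: divide_right_mono)

lemma small_cells:
  assumes "e > 0"
  obtains k where "\<And>j. j \<ge> k \<Longrightarrow> 2 / real N ^ j < e"
proof -
  obtain k where k: "2 / e < real N ^ k" using real_arch_pow[of "real N" "2 / e"] N2 by auto
  have "2 / real N ^ j < e" if "j \<ge> k" for j
  proof -
    have "real N ^ k \<le> real N ^ j" using that N2 by (intro power_increasing) auto
    with k have "2 / e < real N ^ j" by linarith
    then show ?thesis using assms N2 by (simp add: field_simps)
  qed
  with that show ?thesis by blast
qed

abbreviation "xval w \<equiv> radix_value N (map fst w)"
abbreviation "yval w \<equiv> radix_value N (map snd w)"

lemma Phi_coords:
  "real N ^ length w * fst (\<Phi> w y) = fst y + real (xval w)"
  "real N ^ length w * snd (\<Phi> w y) = snd y + real (yval w)"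
proof -
  have "N > 0" using N2 by simp
  then show "real N ^ length w * fst (\<Phi> w y) = fst y + real (xval w)"
    "real N ^ length w * snd (\<Phi> w y) = snd y + real (yval w)"
    by (induction w) (auto simp: gsc_map_def field_simps)
qed

lemma word_val_less: "w \<in> W k \<Longrightarrow> xval w < N ^ k" "w \<in> W k \<Longrightarrow> yval w < N ^ k"
proof -
  assume w: "w \<in> W k"
  have "\<forall>d\<in>set (map fst w). d < N" "\<forall>d\<in>set (map snd w). d < N"
    using w digits unfolding gsc_words_def by auto
  from this[THEN radix_value_less] w show "xval w < N ^ k" "yval w < N ^ k"
    unfolding gsc_words_def by auto
qed

lemma word_eqI:
  assumes w: "v \<in> W k" "w \<in> W k" and eq: "xval v = xval w" "yval v = yval w"
  shows "v = w"
proof -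
  have "\<forall>d\<in>set (map fst u). d < N" "\<forall>d\<in>set (map snd u). d < N" if "u \<in> W k" for u
    using that digits unfolding gsc_words_def by auto
  then have "map fst v = map fst w" "map snd v = map snd w"
    using radix_value_inj[OF _ _ _ eq(1)] radix_value_inj[OF _ _ _ eq(2)] w words_length by auto
  then show ?thesis by (metis zip_map_fst_snd)
qed

lemma unit_coords: "y \<in> F \<Longrightarrow> 0 \<le> fst y \<and> fst y \<le> 1 \<and> 0 \<le> snd y \<and> snd y \<le> 1"
  using F_unit by (cases y) (auto simp flip: cbox_Pair_eq)

text \<open>In either coordinate, the grid index of a cell containing \<open>x\<close> differs from
  the scaled coordinate by an amount between 0 and 1, which leaves two values. The two indices
  determine the word.\<close>

lemma card_cells_containing: "card {w \<in> W k. x \<in> cell w} \<le> 4"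
proof -
  define A where "A t = {nat \<lfloor>t\<rfloor>, nat (\<lfloor>t\<rfloor> - 1)}" for t :: real
  have A: "c \<in> A t" if "0 \<le> t - real c" "t - real c \<le> 1" for c t
  proof -
    have "int c = \<lfloor>t\<rfloor> \<or> int c = \<lfloor>t\<rfloor> - 1" using that by linarith
    then show ?thesis unfolding A_def by (metis insert_iff nat_int)
  qed
  define f where "f w = (xval w, yval w)" for w
  have fA: "f w \<in> A (real N ^ k * fst x) \<times> A (real N ^ k * snd x)" if w: "w \<in> W k" "x \<in> cell w" for w
  proof -
    obtain y where y: "y \<in> F" "x = \<Phi> w y" using w(2) by blast
    have "real N ^ k * fst x = fst y + real (xval w)" "real N ^ k * snd x = snd y + real (yval w)"
      using Phi_coords[of w y] words_length[OF w(1)] y(2) by auto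
    then have "xval w \<in> A (real N ^ k * fst x)" "yval w \<in> A (real N ^ k * snd x)"
      using unit_coords[OF y(1)] by (intro A; simp)+
    then show ?thesis unfolding f_def by simp
  qed
  have fin: "finite (A t)" and two: "card (A t) \<le> 2" for t unfolding A_def by (auto simp: card_insert_if)
  have "card (f ` {w \<in> W k. x \<in> cell w}) \<le> card (A (real N ^ k * fst x) \<times> A (real N ^ k * snd x))"
  proof (rule card_mono)
    show "f ` {w \<in> W k. x \<in> cell w} \<subseteq> A (real N ^ k * fst x) \<times> A (real N ^ k * snd x)"
      using fA by blast
  qed (simp add: fin)
  also have "\<dots> \<le> 2 * 2" unfolding card_cartesian_product by (intro mult_le_mono two)
  finally have "card (f ` {w \<in> W k. x \<in> cell w}) \<le> 4" by simp
  moreover have inj: "inj_on f {w \<in> W k. x \<in> cell w}"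
  proof (rule inj_onI)
    fix v w assume v: "v \<in> {w \<in> W k. x \<in> cell w}" and w: "w \<in> {w \<in> W k. x \<in> cell w}" and f: "f v = f w"
    have "v \<in> W k" "w \<in> W k" using v w by blast+
    moreover have "xval v = xval w" "yval v = yval w" using f unfolding f_def by simp_all
    ultimately show "v = w" by (rule word_eqI)
  qed
  ultimately show ?thesis unfolding card_image[OF inj] by blast
qed

lemma disconnected_cover:
  assumes "A \<union> B = F" "closed A" "closed B" "A \<noteq> {}" "B \<noteq> {}"
  shows "A \<inter> B \<noteq> {}"
  using conn assms unfolding connected_closed by blast

section \<open>Connectedness of the cell graphs\<close>

abbreviation "E \<equiv> gsc_adj N D"

lemma adj_append [simp]: "E (w @ u) (w @ v) \<longleftrightarrow> E u v"
proof -
  have "cell (w @ u) = \<Phi> w ` cell u" for u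
    by (simp add: image_image Phi_append)
  moreover have "\<Phi> w ` A \<inter> \<Phi> w ` B = \<Phi> w ` (A \<inter> B)" for A B
    using image_Int[of "\<Phi> w" A B] Phi_inj by (simp add: inj_def)
  ultimately show ?thesis unfolding gsc_adj_def by simp
qed

lemma adj_sym: "E u v \<Longrightarrow> E v u" unfolding gsc_adj_def by blast

lemma adjI: "u \<noteq> v \<Longrightarrow> x \<in> cell u \<Longrightarrow> x \<in> cell v \<Longrightarrow> E u v"
  unfolding gsc_adj_def by blast

text \<open>The cells of a reachability class and the remaining cells would be two closed sets
  covering the connected set \<open>F\<close>; a common point yields an edge between them.\<close>

lemma words_connected:
  assumes "u \<in> W k" "v \<in> W k"
  shows "reach_in (W k) E u v"
proof (rule ccontr)
  assume v: "\<not> reach_in (W k) E u v"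
  define A where "A = {w \<in> W k. reach_in (W k) E u w}"
  have sub: "A \<subseteq> W k" "W k - A \<subseteq> W k" and mem: "u \<in> A" "v \<in> W k - A"
    using assms v reach_refl unfolding A_def by auto
  have split: "A \<union> (W k - A) = W k" using sub by blast
  have "(\<Union>w\<in>A. cell w) \<union> (\<Union>w\<in>W k - A. cell w) = F"
    unfolding UN_Un[symmetric] split by (rule F_Union_cells[symmetric])
  moreover have "(\<Union>w\<in>X. cell w) \<noteq> {}" if "w \<in> X" for w X
    using that F_nonempty by (simp add: ex_in_conv[symmetric]) blast
  note this[OF mem(1)] this[OF mem(2)]
  ultimately have "(\<Union>w\<in>A. cell w) \<inter> (\<Union>w\<in>W k - A. cell w) \<noteq> {}"
    by (intro disconnected_cover closed_cells[OF sub(1)] closed_cells[OF sub(2)])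
  then obtain x where x: "x \<in> (\<Union>w\<in>A. cell w)" "x \<in> (\<Union>w\<in>W k - A. cell w)" by blast
  obtain a where a: "a \<in> A" "x \<in> cell a" using x(1) by (rule UN_E)
  obtain b where b: "b \<in> W k - A" "x \<in> cell b" using x(2) by (rule UN_E)
  note ab = a(1) b(1) a(2) b(2)
  then have "E a b" by (intro adjI[of a b x]) auto
  moreover have "a \<in> W k" "b \<in> W k" using ab sub by blast+
  ultimately have step: "reach_in (W k) E a b" by (intro reach_step)
  have "reach_in (W k) E u a" using ab(1) unfolding A_def by blast
  from reach_trans[OF this step] have "b \<in> A" using \<open>b \<in> W k\<close> unfolding A_def by blast
  with ab(2) show False by blast
qed

text \<open>Prefixing with \<open>w\<close> preserves adjacency, so a path in the graph of level
  \<open>k\<close> is copied into the descendants of \<open>w\<close>.\<close>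

lemma descendants_connected:
  assumes "u \<in> W k" "v \<in> W k" and X: "\<And>z. z \<in> W k \<Longrightarrow> w @ z \<in> X"
  shows "reach_in X E (w @ u) (w @ v)"
proof -
  have "reach_in (W k) E u v" using words_connected assms by blast
  then show ?thesis unfolding reach_in_def
  proof (induction rule: rtranclp_induct)
    case (step y z)
    then have "w @ y \<in> X \<and> w @ z \<in> X \<and> E (w @ y) (w @ z)" using X by auto
    then show ?case using step.IH by (intro rtranclp.rtrancl_into_rtrancl[OF step.IH]) blast
  qed simp
qed

end

section \<open>Large components yield a cut point\<close>

lemma component_in_eq:
  assumes sym: "\<And>x y. R x y \<Longrightarrow> R y x" and C: "C \<in> components_in X R" and x: "x \<in> C"
  shows "C = component_in X R x"
proof -
  obtain z where z: "C = component_in X R z" using C unfolding components_in_def by blast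
  then have zx: "reach_in X R z x" using x unfolding component_in_def by blast
  have "reach_in X R z y \<longleftrightarrow> reach_in X R x y" for y
  proof
    assume "reach_in X R z y"
    with reach_sym[of R X z x] sym zx show "reach_in X R x y" by (meson reach_trans)
  qed (rule reach_trans[OF zx])
  then show ?thesis unfolding z component_in_def by simp
qed

lemma component_in_subset: "C \<in> components_in X R \<Longrightarrow> C \<subseteq> X"
  unfolding components_in_def component_in_def by blast

lemma finite_components_in: "finite X \<Longrightarrow> finite (components_in X R)"
  unfolding components_in_def by blast

text \<open>A maximum of maxima reaches \<open>c\<close> as soon as one pair of components does. The
  condition \<open>c \<ge> 1\<close> rules out the default value 0 that \<open>chi\<close> takes
  without cut vertices.\<close>

lemma chi_ge_iff:
  assumes V: "finite V" and c: "c \<ge> 1"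
  shows "chi V R \<ge> c \<longleftrightarrow> (\<exists>v\<in>V. \<exists>C1\<in>components_in (V - {v}) R. \<exists>C2\<in>components_in (V - {v}) R.
    C1 \<noteq> C2 \<and> card C1 \<ge> c \<and> card C2 \<ge> c)" (is "_ \<longleftrightarrow> ?R")
proof -
  define S where "S v = {min (card C1) (card C2) | C1 C2.
      C1 \<in> components_in (V - {v}) R \<and> C2 \<in> components_in (V - {v}) R \<and> C1 \<noteq> C2}" for v
  have fin: "finite (components_in (V - {v}) R)" for v using V by (simp add: finite_components_in)
  have finS: "finite (S v)" for v
  proof (rule finite_subset)
    show "S v \<subseteq> (\<lambda>(C1, C2). min (card C1) (card C2)) ` (components_in (V - {v}) R \<times> components_in (V - {v}) R)"
      unfolding S_def by auto
  qed (use fin in simp)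
  have cut: "cut_vertex V R v \<longleftrightarrow> v \<in> V \<and> S v \<noteq> {}" for v
  proof -
    have "card (components_in (V - {v}) R) \<ge> 2 \<longleftrightarrow> (\<exists>C1\<in>components_in (V - {v}) R. \<exists>C2\<in>components_in (V - {v}) R. C1 \<noteq> C2)"
      using fin[of v] by (metis One_nat_def Suc_1 card_le_Suc0_iff_eq not_less_eq_eq)
    then show ?thesis unfolding cut_vertex_def S_def by blast
  qed
  have second: "second_largest_comp (V - {v}) R = Max (S v)" for v
    unfolding second_largest_comp_def S_def ..
  define T where "T = {Max (S v) | v. v \<in> V \<and> S v \<noteq> {}}"
  have "T \<subseteq> (\<lambda>v. Max (S v)) ` V" unfolding T_def by blast
  then have finT: "finite T" using V finite_subset by blast
  have chi: "chi V R = (if \<exists>v. v \<in> V \<and> S v \<noteq> {} then Max T else 0)"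
    unfolding chi_def cut second T_def ..
  have "chi V R \<ge> c \<longleftrightarrow> (\<exists>v\<in>V. \<exists>s\<in>S v. s \<ge> c)"
  proof (cases "T = {}")
    case True
    then have "\<forall>v\<in>V. S v = {}" unfolding T_def by blast
    then show ?thesis using chi c by auto
  next
    case False
    then have "chi V R = Max T" unfolding chi T_def by auto
    then have "chi V R \<ge> c \<longleftrightarrow> (\<exists>t\<in>T. t \<ge> c)" using False finT by (simp add: Max_ge_iff)
    also have "\<dots> \<longleftrightarrow> (\<exists>v\<in>V. S v \<noteq> {} \<and> Max (S v) \<ge> c)" unfolding T_def by auto
    also have "\<dots> \<longleftrightarrow> (\<exists>v\<in>V. \<exists>s\<in>S v. s \<ge> c)" using finS by (metis Max_ge_iff empty_iff)
    finally show ?thesis .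
  qed
  also have "\<dots> \<longleftrightarrow> ?R" unfolding S_def by fastforce
  finally show ?thesis .
qed

section \<open>Chains of cells avoiding a point\<close>

context connected_gsc begin

definition avoiding :: "real \<times> real \<Rightarrow> (nat \<times> nat) list set" where
  "avoiding x = {w. set w \<subseteq> D \<and> x \<notin> cell w}"

lemma avoiding_connected:
  assumes conn': "connected (F - {x})" and a: "a \<in> avoiding x" and b: "b \<in> avoiding x"
  shows "reach_in (avoiding x) E a b"
proof -
  let ?G = "avoiding x"
  let ?r = "reach_in ?G E"
  have rsym: "?r u v \<Longrightarrow> ?r v u" for u v by (rule reach_sym) (rule adj_sym)
  have meet: "?r u v" if "u \<in> ?G" "v \<in> ?G" "y \<in> cell u" "y \<in> cell v" for u v y
  proof (cases "u = v")
    case False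
    then have "E u v" using that(3,4) by (rule adjI)
    with that(1,2) show ?thesis by (rule reach_step)
  qed (simp add: reach_refl)
  have sub: "cell w \<subseteq> F" if "w \<in> ?G" for w
    using that Phi_in_F[of w "length w"] unfolding avoiding_def gsc_words_def by blast
  define R where "R y z \<longleftrightarrow> (\<exists>u\<in>?G. \<exists>v\<in>?G. y \<in> cell u \<and> z \<in> cell v \<and> ?r u v)" for y z
  obtain f where f: "f \<in> F" using F_nonempty by blast
  have mem: "\<Phi> w f \<in> cell w" "w \<in> ?G \<Longrightarrow> \<Phi> w f \<in> F - {x}" for w
  proof -
    show *: "\<Phi> w f \<in> cell w" using f by blast
    assume w: "w \<in> ?G"
    then have "x \<notin> cell w" unfolding avoiding_def by blast
    with * sub[OF w] show "\<Phi> w f \<in> F - {x}" by blast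
  qed
  have "R (\<Phi> a f) (\<Phi> b f)"
  proof (rule connected_equivalence_relation[OF conn' mem(2)[OF a] mem(2)[OF b]])
    fix y z assume "R y z"
    then show "R z y" unfolding R_def using rsym by blast
  next
    fix y z t assume "R y z" "R z t"
    then obtain u v u' v' where w: "u \<in> ?G" "v \<in> ?G" "y \<in> cell u" "z \<in> cell v" "?r u v"
      "u' \<in> ?G" "v' \<in> ?G" "z \<in> cell u'" "t \<in> cell v'" "?r u' v'" unfolding R_def by blast
    have "?r v u'" using w by (intro meet[of v u' z])
    from reach_trans[OF reach_trans[OF w(5) this] w(10)] have "?r u v'" .
    then show "R y t" unfolding R_def using w by blast
  next
    fix y assume y: "y \<in> F - {x}"
    \<comment> \<open>Cells of level \<open>k\<close> through \<open>y\<close> are too small to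
      contain \<open>x\<close>. The finitely many others form a closed set \<open>C\<close> missing
      \<open>y\<close>, so each nearby point shares with \<open>y\<close> a cell that avoids
      \<open>x\<close>.\<close>
    obtain k where k: "2 / real N ^ k < dist y x / 2" using small_cells[of "dist y x / 2"] y by auto
    define C where "C = (\<Union>w\<in>{w \<in> W k. y \<notin> cell w}. cell w)"
    have "closed C" unfolding C_def by (rule closed_cells[of _ k]) blast
    moreover have "y \<notin> C" unfolding C_def by blast
    ultimately have T: "open (ball y (dist y x / 2) - C)" "y \<in> ball y (dist y x / 2) - C"
      using y by auto
    have "R y z" if z: "z \<in> F - {x}" "z \<in> ball y (dist y x / 2) - C" for z
    proof -
      obtain w where w: "w \<in> W k" "z \<in> cell w" using z F_Union_cells[of k] by blast
      then have yw: "y \<in> cell w" using z unfolding C_def by blast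
      have "x \<notin> cell w"
      proof
        assume "x \<in> cell w"
        from dist_cell[OF w(1) yw this] k zero_le_dist[of y x] show False by linarith
      qed
      then have "w \<in> ?G" using w unfolding avoiding_def gsc_words_def by blast
      then show ?thesis using yw w(2) reach_refl[of ?G E w] unfolding R_def by blast
    qed
    then show "\<exists>T. openin (top_of_set (F - {x})) T \<and> y \<in> T \<and> (\<forall>z\<in>T. R y z)"
      using T y by (intro exI[of _ "(F - {x}) \<inter> (ball y (dist y x / 2) - C)"] conjI openin_open_Int) auto
  qed
  then obtain u v where uv: "u \<in> ?G" "v \<in> ?G" "\<Phi> a f \<in> cell u" "\<Phi> b f \<in> cell v" "?r u v"
    unfolding R_def by blast
  have "?r a u" using meet[OF a uv(1) mem(1) uv(3)] .
  moreover have "?r v b" using meet[OF uv(2) b uv(4) mem(1)] .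
  ultimately show ?thesis using uv(5) by (meson reach_trans)
qed

text \<open>Cells of words sharing a prefix are images under one map, which lets statements about
  descendants be pulled back.\<close>

lemma cell_append: "cell (v @ w) = \<Phi> v ` cell w"
  by (simp add: image_image Phi_append)

lemma cell_append_subset:
  assumes "w \<in> W k"
  shows "cell (v @ w) \<subseteq> cell v"
proof -
  have "cell w \<subseteq> F" using Phi_in_F[OF assms] by blast
  then show ?thesis unfolding cell_append by blast
qed

lemma descendant_containing:
  assumes "x \<in> cell v"
  shows "\<exists>w\<in>W k. x \<in> cell (v @ w)"
proof -
  obtain y where y: "y \<in> F" "x = \<Phi> v y" using assms by blast
  obtain w z where "w \<in> W k" "z \<in> F" "y = \<Phi> w z" using ex_word[OF y(1)] by blast
  with y show ?thesis by (intro bexI[of _ w]) (simp_all add: Phi_append)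
qed

lemma cell_nonempty: "cell w \<noteq> {}" using F_nonempty by blast

lemma cut_point_if_chi_large:
  assumes large: "\<And>k. k \<ge> k0 \<Longrightarrow> Gamma_chi N D k \<ge> card D ^ (k - 1)"
  shows "has_cut_point F"
proof (rule ccontr)
  assume no_cut: "\<not> has_cut_point F"
  have pos: "card D ^ j \<ge> 1" for j using card_D by simp
  define P where "P k v C1 C2 \<longleftrightarrow> v \<in> W k \<and> C1 \<in> components_in (W k - {v}) E \<and>
      C2 \<in> components_in (W k - {v}) E \<and> C1 \<noteq> C2 \<and> card C1 \<ge> card D ^ (k - 1) \<and> card C2 \<ge> card D ^ (k - 1)"
    for k v C1 C2
  have "\<exists>v C1 C2. P k v C1 C2" if "k \<ge> k0" for k
    using large[OF that] unfolding P_def Gamma_chi_def chi_ge_iff[OF finite_words pos] by blast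
  then obtain v where "\<And>k. k \<ge> k0 \<Longrightarrow> \<exists>C1 C2. P k (v k) C1 C2" by metis
  then obtain C1 where "\<And>k. k \<ge> k0 \<Longrightarrow> \<exists>C2. P k (v k) (C1 k) C2" by metis
  then obtain C2 where P: "\<And>k. k \<ge> k0 \<Longrightarrow> P k (v k) (C1 k) (C2 k)" by metis
  note v = P[unfolded P_def, THEN conjunct1]
    and C1 = P[unfolded P_def, THEN conjunct2, THEN conjunct1]
    and C2 = P[unfolded P_def, THEN conjunct2, THEN conjunct2, THEN conjunct1]
    and ne = P[unfolded P_def, THEN conjunct2, THEN conjunct2, THEN conjunct2, THEN conjunct1]
    and c1 = P[unfolded P_def, THEN conjunct2, THEN conjunct2, THEN conjunct2, THEN conjunct2, THEN conjunct1]
    and c2 = P[unfolded P_def, THEN conjunct2, THEN conjunct2, THEN conjunct2, THEN conjunct2, THEN conjunct2]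
  obtain f where f: "f \<in> F" using F_nonempty by blast
  define X where "X m = \<Phi> (v (k0 + 4 + m)) f" for m
  \<comment> \<open>\<open>X\<close> picks a point in each cut-vertex cell, so that these cells
    accumulate at a limit \<open>x\<close>. The shift by 4 guarantees that the words have a prefix
    of length 4.\<close>
  have "X m \<in> F" for m unfolding X_def by (rule Phi_in_F[OF v f]) simp
  then obtain x r where x: "x \<in> F" and r: "strict_mono (r :: nat \<Rightarrow> nat)" and lim: "(X \<circ> r) \<longlonglongrightarrow> x"
    using compact_F unfolding compact_def by meson
  define K where "K m = k0 + 4 + r m" for m
  have K: "K m \<ge> k0" "K m \<ge> 4" "K m \<ge> m" for m
    using seq_suble[OF r, of m] unfolding K_def by auto
  have XK: "(X \<circ> r) m \<in> cell (v (K m))" for m using f unfolding X_def K_def by auto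
  have conn': "connected (F - {x})" using no_cut x unfolding has_cut_point_def by blast
  let ?G = "avoiding x"
  have disj: "\<forall>\<^sub>F m in sequentially. cell (v (K m)) \<inter> cell w = {}" if w: "w \<in> ?G" for w
  proof -
    have "open (- cell w)" using compact_imp_closed[OF compact_cell] by auto
    moreover have "x \<in> - cell w" using w unfolding avoiding_def by blast
    ultimately obtain e where e: "e > 0" "ball x e \<subseteq> - cell w" unfolding open_contains_ball by blast
    obtain k where k: "\<And>j. j \<ge> k \<Longrightarrow> 2 / real N ^ j < e / 2" using small_cells[of "e / 2"] e(1) by auto
    have "\<forall>\<^sub>F m in sequentially. dist ((X \<circ> r) m) x < e / 2" by (rule tendstoD[OF lim]) (use e(1) in simp)
    then have "\<forall>\<^sub>F m in sequentially. dist ((X \<circ> r) m) x < e / 2 \<and> m \<ge> k"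
      using eventually_ge_at_top by (rule eventually_conj)
    then show ?thesis
    proof (rule eventually_mono)
      fix m assume m: "dist ((X \<circ> r) m) x < e / 2 \<and> m \<ge> k"
      have "z \<in> ball x e" if z: "z \<in> cell (v (K m))" for z
      proof -
        have "dist ((X \<circ> r) m) z \<le> 2 / real N ^ K m" by (rule dist_cell[OF v[OF K(1)] XK z])
        moreover have "2 / real N ^ K m < e / 2" using k K(3)[of m] m by simp
        ultimately have "dist ((X \<circ> r) m) z < e / 2" by linarith
        with m dist_triangle[of x z "(X \<circ> r) m"] show ?thesis by (simp add: dist_commute)
      qed
      with e(2) show "cell (v (K m)) \<inter> cell w = {}" by blast
    qed
  qed
  \<comment> \<open>\<open>S m w w'\<close> compares cells of different levels through all their
    descendants of level \<open>K m\<close>. A chain of cells thereby becomes a path in one graph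
    that misses the cut vertex.\<close>
  define S where "S m w w' \<longleftrightarrow> length w \<le> K m \<and> length w' \<le> K m \<and>
     (\<forall>z\<in>W (K m - length w). \<forall>z'\<in>W (K m - length w'). reach_in (W (K m) - {v (K m)}) E (w @ z) (w' @ z'))" for m w w'
  have inX: "w @ z \<in> W (K m) - {v (K m)}"
    if "cell (v (K m)) \<inter> cell w = {}" "length w \<le> K m" "w \<in> ?G" "z \<in> W (K m - length w)" for w z m
  proof -
    have "w @ z \<in> W (K m)" using that unfolding gsc_words_def avoiding_def by auto
    moreover have "w @ z \<noteq> v (K m)"
    proof
      assume "w @ z = v (K m)"
      then have "cell (v (K m)) \<subseteq> cell w" using cell_append_subset[OF that(4), of w] by simp
      with that(1) cell_nonempty[of "v (K m)"] show False by blast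
    qed
    ultimately show ?thesis by blast
  qed
  have S_refl: "S m w w" if "cell (v (K m)) \<inter> cell w = {}" "length w \<le> K m" "w \<in> ?G" for m w
    unfolding S_def using that inX[OF that] by (auto intro!: descendants_connected)
  have S_ev: "\<forall>\<^sub>F m in sequentially. cell (v (K m)) \<inter> cell w = {} \<and> length w \<le> K m" if "w \<in> ?G" for w
  proof (rule eventually_conj[OF disj[OF that]])
    show "\<forall>\<^sub>F m in sequentially. length w \<le> K m"
      using eventually_ge_at_top[of "length w"] by (rule eventually_mono) (use K(3) le_trans in blast)
  qed
  have S: "\<forall>\<^sub>F m in sequentially. S m a b" if "a \<in> ?G" "reach_in ?G E a b" for a b
    using that(2) unfolding reach_in_def
  proof (induction rule: rtranclp_induct)
    case base
    show ?case using S_ev[OF that(1)] by (rule eventually_mono) (use S_refl that(1) in blast)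
  next
    case (step b c)
    from step.hyps have bc: "b \<in> ?G" "c \<in> ?G" "E b c" by blast+
    then obtain p where p: "p \<in> cell b" "p \<in> cell c" unfolding gsc_adj_def by blast
    have "\<forall>\<^sub>F m in sequentially. S m a b \<and> (cell (v (K m)) \<inter> cell b = {} \<and> length b \<le> K m) \<and>
        (cell (v (K m)) \<inter> cell c = {} \<and> length c \<le> K m)"
      by (intro eventually_conj step.IH S_ev bc)
    then show ?case
    proof (rule eventually_mono)
      fix m assume m: "S m a b \<and> (cell (v (K m)) \<inter> cell b = {} \<and> length b \<le> K m) \<and>
        (cell (v (K m)) \<inter> cell c = {} \<and> length c \<le> K m)"
      obtain u where u: "u \<in> W (K m - length b)" "p \<in> cell (b @ u)" using descendant_containing[OF p(1)] by blast
      obtain u' where u': "u' \<in> W (K m - length c)" "p \<in> cell (c @ u')" using descendant_containing[OF p(2)] by blast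
      let ?r = "reach_in (W (K m) - {v (K m)}) E"
      have in1: "b @ u \<in> W (K m) - {v (K m)}" using m bc u by (intro inX) auto
      have in2: "c @ u' \<in> W (K m) - {v (K m)}" using m bc u' by (intro inX) auto
      have mid: "?r (b @ u) (c @ u')"
      proof (cases "b @ u = c @ u'")
        case False
        then have "E (b @ u) (c @ u')" using u(2) u'(2) by (rule adjI)
        with in1 in2 show ?thesis by (rule reach_step)
      qed (simp add: reach_refl)
      have cc: "S m c c" using m bc by (intro S_refl) auto
      show "S m a c" unfolding S_def
      proof (intro conjI ballI)
        fix z z' assume z: "z \<in> W (K m - length a)" "z' \<in> W (K m - length c)"
        have "?r (a @ z) (b @ u)" using m z(1) u(1) unfolding S_def by blast
        from reach_trans[OF this mid] have "?r (a @ z) (c @ u')" .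
        moreover have "?r (c @ u') (c @ z')" using cc u'(1) z(2) unfolding S_def by blast
        ultimately show "?r (a @ z) (c @ z')" by (rule reach_trans)
      qed (use m S_def in auto)
    qed
  qed
  define H where "H = {w \<in> W 4. x \<notin> cell w}"
  have HG: "H \<subseteq> ?G" unfolding H_def avoiding_def gsc_words_def by blast
  have finH: "finite H" unfolding H_def using finite_words by simp
  have "\<forall>\<^sub>F m in sequentially. \<forall>a\<in>H. \<forall>b\<in>H. S m a b"
    by (intro eventually_ball_finite finH ballI S avoiding_connected conn') (use HG in auto)
  then obtain m where m: "\<forall>a\<in>H. \<forall>b\<in>H. S m a b"
    using eventually_happens'[OF sequentially_bot] by blast
  define k where "k = K m"
  have k: "k \<ge> k0" "k \<ge> 4" using K unfolding k_def by auto
  \<comment> \<open>A component with more than \<open>card B\<close> words contains a descendant of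
    some cell in \<open>H\<close>. By \<open>S\<close>, two such components are the same.\<close>
  define B where "B = {u \<in> W k. x \<in> cell (take 4 u)}"
  have "B \<subseteq> (\<lambda>(p, q). p @ q) ` ({w \<in> W 4. x \<in> cell w} \<times> W (k - 4))"
  proof
    fix u assume u: "u \<in> B"
    then have "u \<in> W (4 + (k - 4))" using k unfolding B_def by simp
    then have "take 4 u \<in> W 4" "drop 4 u \<in> W (k - 4)" by (rule words_take, rule words_drop)
    with u show "u \<in> (\<lambda>(p, q). p @ q) ` ({w \<in> W 4. x \<in> cell w} \<times> W (k - 4))"
      unfolding B_def by (intro image_eqI[of _ _ "(take 4 u, drop 4 u)"]) auto
  qed
  then have "card B \<le> card ({w \<in> W 4. x \<in> cell w} \<times> W (k - 4))"
    using finite_words by (intro surj_card_le) auto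
  also have "\<dots> \<le> 4 * card D ^ (k - 4)"
    unfolding card_cartesian_product card_words by (intro mult_le_mono card_cells_containing order_refl)
  also have "\<dots> < card D ^ (k - 1)"
  proof -
    \<comment> \<open>This is why prefixes of length 4 are taken: for \<open>card D = 2\<close>,
      length 3 would not make the inequality strict.\<close>
    have "4 < (2 :: nat) ^ 3" by simp
    also have "\<dots> \<le> card D ^ 3" using card_D by (rule power_mono) simp
    finally have "4 * card D ^ (k - 4) < card D ^ 3 * card D ^ (k - 4)" using card_D by simp
    also have "\<dots> = card D ^ (k - 1)" using k(2) by (simp flip: power_add)
    finally show ?thesis .
  qed
  finally have cB: "card B < card D ^ (k - 1)" .
  have finB: "finite B" unfolding B_def using finite_words by simp
  have ex: "\<exists>u\<in>C. \<exists>p\<in>H. \<exists>q\<in>W (k - length p). u = p @ q"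
    if C: "C \<subseteq> W k" "card C \<ge> card D ^ (k - 1)" for C
  proof -
    have "\<not> C \<subseteq> B" using card_mono[OF finB, of C] cB C(2) by linarith
    then obtain u where u: "u \<in> C" "u \<notin> B" by blast
    then have uw: "u \<in> W (4 + (k - 4))" using C(1) k by auto
    have "take 4 u \<in> H" using words_take[OF uw] u C(1) unfolding H_def B_def by blast
    moreover have "drop 4 u \<in> W (k - length (take 4 u))"
      using words_drop[OF uw] words_length[OF words_take[OF uw]] by simp
    ultimately show ?thesis using u(1) by (metis append_take_drop_id)
  qed
  have sub: "C1 k \<subseteq> W k" "C2 k \<subseteq> W k" using component_in_subset C1[OF k(1)] C2[OF k(1)] by blast+
  obtain u1 p1 q1 where u1: "u1 \<in> C1 k" "p1 \<in> H" "q1 \<in> W (k - length p1)" "u1 = p1 @ q1"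
    using ex[OF sub(1) c1[OF k(1)]] by blast
  obtain u2 p2 q2 where u2: "u2 \<in> C2 k" "p2 \<in> H" "q2 \<in> W (k - length p2)" "u2 = p2 @ q2"
    using ex[OF sub(2) c2[OF k(1)]] by blast
  have "S m p1 p2" using m u1 u2 by blast
  then have reach: "reach_in (W k - {v k}) E u1 u2" using u1 u2 unfolding S_def k_def by blast
  have e1: "C1 k = component_in (W k - {v k}) E u1" by (rule component_in_eq[OF adj_sym C1[OF k(1)] u1(1)])
  have e2: "C2 k = component_in (W k - {v k}) E u2" by (rule component_in_eq[OF adj_sym C2[OF k(1)] u2(1)])
  have "u2 \<in> C1 k" unfolding e1 component_in_def
    using reach component_in_subset[OF C2[OF k(1)]] u2(1) by blast
  from component_in_eq[OF adj_sym C1[OF k(1)] this] e2 ne[OF k(1)] show False by simp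
qed

end

section \<open>A cut point yields large components\<close>

text \<open>\<open>t\<close> is a coordinate of a point in three grid cells with indices
  \<open>A\<close>, \<open>B\<close>, \<open>C\<close> and local coordinates \<open>a\<close>,
  \<open>b\<close>, \<open>y\<close>. Two different indices force \<open>T * t\<close> to be an
  integer, and then every local coordinate is 0 or 1. At the ends of the unit interval only one
  index is possible.\<close>

lemma grid_boundary:
  fixes T A B C :: nat and t a b y :: real
  assumes eq: "real T * t = a + real A" "real T * t = b + real B" "real T * t = y + real C"
    and less: "A < T" "B < T" "C < T"
    and unit: "0 \<le> a" "a \<le> 1" "0 \<le> b" "b \<le> 1" "0 \<le> y" "y \<le> 1"
  shows "t = 0 \<or> t = 1 \<Longrightarrow> A = B" "t = 0 \<or> t = 1 \<Longrightarrow> y = 0 \<or> y = 1" "A \<noteq> B \<Longrightarrow> y = 0 \<or> y = 1"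
proof -
  have integer: "y = 0 \<or> y = 1" if "real T * t = real m" for m :: nat
  proof -
    have "m = C \<or> m = C + 1" using that eq(3) unit(5,6) by linarith
    then show ?thesis using that eq(3) by auto
  qed
  show "A = B" if "t = 0 \<or> t = 1"
    using that
  proof
    assume "t = 0"
    then show ?thesis using eq unit by simp
  next
    assume "t = 1"
    then have "real T = a + real A" "real T = b + real B" using eq by simp_all
    then show ?thesis using unit less by linarith
  qed
  show "y = 0 \<or> y = 1" if "t = 0 \<or> t = 1" using that integer[of 0] integer[of T] by auto
  show "y = 0 \<or> y = 1" if "A \<noteq> B"
  proof -
    have "A = B + 1 \<or> B = A + 1" using that eq unit by linarith
    then have "a = 0 \<or> b = 0" using eq unit by auto
    then show ?thesis
    proof
      assume "a = 0"
      then show ?thesis using integer[of A] eq(1) by simp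
    next
      assume "b = 0"
      then show ?thesis using integer[of B] eq(2) by simp
    qed
  qed
qed

section \<open>Separations and their preimages in cells\<close>

context connected_gsc begin

text \<open>Closedness of \<open>insert x U\<close> and \<open>insert x V\<close> says that both
  sides are relatively closed in \<open>F - {x}\<close>.\<close>

definition separates :: "real \<times> real \<Rightarrow> (real \<times> real) set \<Rightarrow> (real \<times> real) set \<Rightarrow> bool" where
  "separates x U V \<longleftrightarrow> x \<in> F \<and> U \<noteq> {} \<and> V \<noteq> {} \<and> U \<inter> V = {} \<and> U \<union> V = F - {x} \<and>
     closed (insert x U) \<and> closed (insert x V)"

definition pull :: "(nat \<times> nat) list \<Rightarrow> (real \<times> real) set \<Rightarrow> (real \<times> real) set" where
  "pull w S = {z \<in> F. \<Phi> w z \<in> S}"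

lemma separates_sym: "separates x U V \<Longrightarrow> separates x V U"
  unfolding separates_def by (simp add: Un_commute Int_commute)

lemma separates_disjoint: "separates x U V \<Longrightarrow> U \<inter> V = {}"
  unfolding separates_def by simp

lemma pull_disjoint: "U \<inter> V = {} \<Longrightarrow> pull w U \<inter> pull w V = {}"
  unfolding pull_def by blast

lemma separates_if_cut_point:
  assumes "has_cut_point F"
  shows "\<exists>x U V. separates x U V"
proof -
  obtain x where x: "x \<in> F" "\<not> connected (F - {x})" using assms unfolding has_cut_point_def by blast
  obtain A B where AB: "closed A" "closed B" "F - {x} \<subseteq> A \<union> B" "A \<inter> B \<inter> (F - {x}) = {}"
    "A \<inter> (F - {x}) \<noteq> {}" "B \<inter> (F - {x}) \<noteq> {}" using x(2) unfolding connected_closed by auto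
  have "insert x (S \<inter> (F - {x})) = insert x (S \<inter> F)" for S by blast
  moreover have "closed (insert x (S \<inter> F))" if "closed S" for S
    using that compact_imp_closed[OF compact_F] by (intro closed_insert closed_Int)
  ultimately have "separates x (A \<inter> (F - {x})) (B \<inter> (F - {x}))"
    unfolding separates_def using x(1) AB by auto
  then show ?thesis by blast
qed

lemma separates_connected:
  assumes sep: "separates x U V" and C: "connected C" "C \<subseteq> F" "x \<notin> C"
  shows "C \<subseteq> U \<or> C \<subseteq> V"
proof -
  have "insert x U \<inter> C = {} \<or> insert x V \<inter> C = {}"
    using sep C unfolding separates_def by (intro connected_closedD[OF C(1)]) auto
  then show ?thesis using sep C unfolding separates_def by blast
qed

lemma cell_subset_F: "w \<in> W k \<Longrightarrow> cell w \<subseteq> F"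
  using Phi_in_F by blast

text \<open>The map of a word is injective and continuous, so disjointness, covering and closedness
  all pass to preimages; that the cell meets both sides makes these nonempty.\<close>

lemma pull_separates:
  assumes sep: "separates (\<Phi> w y) U V" and w: "w \<in> W k" and y: "y \<in> F"
    and "cell w \<inter> U \<noteq> {}" "cell w \<inter> V \<noteq> {}"
  shows "separates y (pull w U) (pull w V)"
proof -
  have cl: "closed (insert y (pull w S))" if "closed (insert (\<Phi> w y) S)" for S
  proof -
    have "z \<in> insert y (pull w S) \<longleftrightarrow> z \<in> F \<inter> \<Phi> w -` insert (\<Phi> w y) S" for z
      using y Phi_inj[of w z y] unfolding pull_def by auto
    then have "insert y (pull w S) = F \<inter> \<Phi> w -` insert (\<Phi> w y) S" by blast
    then show ?thesis
      using continuous_closed_preimage[OF continuous_on_Phi compact_imp_closed[OF compact_F] that] by simp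
  qed
  have "pull w U \<union> pull w V = F - {y}"
  proof -
    have "z \<in> pull w U \<union> pull w V \<longleftrightarrow> z \<in> F \<and> \<Phi> w z \<in> U \<union> V" for z unfolding pull_def by blast
    moreover have "\<Phi> w z \<in> U \<union> V \<longleftrightarrow> z \<noteq> y" if "z \<in> F" for z
      using sep Phi_in_F[OF w that] Phi_inj[of w z y] unfolding separates_def by simp
    ultimately show ?thesis by blast
  qed
  moreover have "pull w U \<noteq> {}" "pull w V \<noteq> {}" using assms(4,5) unfolding pull_def by blast+
  ultimately show ?thesis
    using sep y cl pull_disjoint[OF separates_disjoint[OF sep]] unfolding separates_def by simp
qed

lemma cell_single: "cell [i] = \<phi> i ` F"
  by simp

section \<open>Cut points with a single address\<close>

definition uniquely_addressed :: "real \<times> real \<Rightarrow> bool" where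
  "uniquely_addressed x \<longleftrightarrow> (\<forall>k. \<forall>v\<in>W k. \<forall>w\<in>W k. x \<in> cell v \<longrightarrow> x \<in> cell w \<longrightarrow> v = w)"

lemma uniquely_addressedD:
  "uniquely_addressed x \<Longrightarrow> v \<in> W k \<Longrightarrow> w \<in> W k \<Longrightarrow> x \<in> cell v \<Longrightarrow> x \<in> cell w \<Longrightarrow> v = w"
  unfolding uniquely_addressed_def by blast

lemma uniquely_addressed_pull:
  assumes u: "uniquely_addressed (\<Phi> w y)" and w: "w \<in> W j"
  shows "uniquely_addressed y"
  unfolding uniquely_addressed_def
proof (intro allI ballI impI)
  fix k v v' assume v: "v \<in> W k" "v' \<in> W k" "y \<in> cell v" "y \<in> cell v'"
  then have "\<Phi> w y \<in> cell (w @ v)" "\<Phi> w y \<in> cell (w @ v')" unfolding cell_append by blast+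
  with uniquely_addressedD[OF u words_append[OF w v(1)] words_append[OF w v(2)]] show "v = v'" by simp
qed

definition all_others_in :: "nat \<times> nat \<Rightarrow> (real \<times> real) set \<Rightarrow> bool" where
  "all_others_in i S \<longleftrightarrow> (\<forall>a\<in>D - {i}. cell [a] \<subseteq> S)"

text \<open>Apart from the one cell \<open>v\<close> around \<open>x\<close>, each cell of level
  \<open>Suc j\<close> lies on one side, and no edge joins the two sides. Both sides contain a
  first-level cell other than \<open>i\<close>, whose \<open>card D ^ j\<close> descendants lie in
  one component.\<close>

lemma balanced_chi:
  assumes sep: "separates x U V" and u: "uniquely_addressed x" and i: "i \<in> D" "x \<in> cell [i]"
    and no: "\<not> all_others_in i U" "\<not> all_others_in i V"
  shows "Gamma_chi N D (Suc j) \<ge> card D ^ j"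
proof -
  have w1: "[a] \<in> W 1" if "a \<in> D" for a using that unfolding gsc_words_def by simp
  have notin: "x \<notin> cell [a]" if "a \<in> D - {i}" for a
    using uniquely_addressedD[OF u w1[of a] w1[of i] _ i(2)] that i(1) by auto
  have side: "cell [a] \<subseteq> U \<or> cell [a] \<subseteq> V" if "a \<in> D - {i}" for a
    using that by (intro separates_connected[OF sep connected_cell cell_subset_F[OF w1] notin]) auto
  obtain a where a: "a \<in> D - {i}" "cell [a] \<subseteq> V" using no(1) side unfolding all_others_in_def by blast
  obtain b where b: "b \<in> D - {i}" "cell [b] \<subseteq> U" using no(2) side unfolding all_others_in_def by blast
  have "x \<in> F" using sep unfolding separates_def by simp
  then obtain v where v: "v \<in> W (Suc j)" "x \<in> cell v" using F_Union_cells[of "Suc j"] by blast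
  let ?X = "W (Suc j) - {v}"
  have side': "cell w \<subseteq> U \<or> cell w \<subseteq> V" if w: "w \<in> ?X" for w
  proof -
    have "x \<notin> cell w" using uniquely_addressedD[OF u _ v(1) _ v(2), of w] w by auto
    then show ?thesis using w by (intro separates_connected[OF sep connected_cell cell_subset_F]) auto
  qed
  have sub: "cell (c # z) \<subseteq> cell [c]" if "z \<in> W j" for c z
    using cell_append_subset[OF that, of "[c]"] by simp
  have inX: "c # z \<in> ?X" if "c \<in> D - {i}" "z \<in> W j" for c z
    using that sub[OF that(2), of c] notin[OF that(1)] v(2) by auto
  have big: "card (component_in ?X E (c # z)) \<ge> card D ^ j" if c: "c \<in> D - {i}" "z \<in> W j" for c z
  proof -
    have "(#) c ` W j \<subseteq> component_in ?X E (c # z)"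
    proof
      fix w assume "w \<in> (#) c ` W j"
      then obtain z' where z': "w = c # z'" "z' \<in> W j" by blast
      have "reach_in ?X E ([c] @ z) ([c] @ z')"
        by (rule descendants_connected[OF c(2) z'(2)]) (use inX[OF c(1)] in simp)
      then show "w \<in> component_in ?X E (c # z)" using z' inX[OF c(1) z'(2)] unfolding component_in_def by simp
    qed
    moreover have "finite (component_in ?X E (c # z))"
      using finite_words[of "Suc j"] by (rule rev_finite_subset) (auto simp: component_in_def)
    ultimately have "card ((#) c ` W j) \<le> card (component_in ?X E (c # z))" by (intro card_mono)
    then show ?thesis by (simp add: card_image card_words)
  qed
  obtain z where z: "z \<in> W j" using words_nonempty by blast
  have ne: "component_in ?X E (a # z) \<noteq> component_in ?X E (b # z)"
  proof
    assume "component_in ?X E (a # z) = component_in ?X E (b # z)"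
    then have "reach_in ?X E (a # z) (b # z)"
      using inX[OF b(1) z] reach_refl[of ?X E "b # z"] unfolding component_in_def by blast
    then have "b # z \<in> {w. cell w \<subseteq> V}"
    proof (rule reach_invariant)
      show "a # z \<in> {w. cell w \<subseteq> V}" using sub[OF z, of a] a(2) by blast
      fix w w' assume w: "w \<in> ?X" "w' \<in> ?X" "E w w'" "w \<in> {w. cell w \<subseteq> V}"
      then obtain p where "p \<in> cell w" "p \<in> cell w'" unfolding gsc_adj_def by blast
      with w(4) side'[OF w(2)] separates_disjoint[OF sep] show "w' \<in> {w. cell w \<subseteq> V}" by blast
    qed
    then have "cell (b # z) \<subseteq> V" "cell (b # z) \<subseteq> U" using sub[OF z, of b] b(2) by blast+
    then show False using separates_disjoint[OF sep] cell_nonempty[of "b # z"] by blast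
  qed
  have comp: "component_in ?X E (c # z) \<in> components_in ?X E" if "c \<in> D - {i}" for c
    using inX[OF that z] unfolding components_in_def by blast
  have one: "card D ^ j \<ge> 1" using card_D by simp
  show ?thesis
    unfolding Gamma_chi_def chi_ge_iff[OF finite_words one]
    using v(1) comp[OF a(1)] comp[OF b(1)] ne big[OF a(1) z] big[OF b(1) z] by blast
qed

end

section \<open>Pulling back cut points in the non-fragile case\<close>

locale nonfragile_gsc = connected_gsc +
  assumes nonfragile: "\<not> fragile N D"
begin

text \<open>By connectedness the two unions meet, and a single common point would make the partition
  a witness of fragility.\<close>

lemma two_contacts:
  assumes "D1 \<noteq> {}" "D2 \<noteq> {}" "D1 \<inter> D2 = {}" "D1 \<union> D2 = D"
  shows "\<exists>p q. p \<noteq> q \<and> {p, q} \<subseteq> (\<Union>i\<in>D1. cell [i]) \<inter> (\<Union>i\<in>D2. cell [i])"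
proof -
  have cells: "(\<Union>i\<in>X. cell [i]) = (\<Union>i\<in>X. \<phi> i ` F)" for X by simp
  have closed: "closed (\<Union>i\<in>X. cell [i])" if "X \<subseteq> D" for X
    using finite_subset[OF that finite_D] by (intro closed_UN ballI compact_imp_closed compact_cell)
  have cover: "(\<Union>i\<in>D1. cell [i]) \<union> (\<Union>i\<in>D2. cell [i]) = F"
    unfolding cells UN_Un[symmetric] assms(4) by (rule F_eq[symmetric])
  have ne: "(\<Union>i\<in>X. cell [i]) \<noteq> {}" if "X \<noteq> {}" for X using that cell_nonempty by auto
  define C where "C = (\<Union>i\<in>D1. cell [i]) \<inter> (\<Union>i\<in>D2. cell [i])"
  have "C \<noteq> {}" unfolding C_def
    by (rule disconnected_cover[OF cover closed closed ne[OF assms(1)] ne[OF assms(2)]]) (simp_all add: assms(4)[symmetric])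
  then obtain p where p: "p \<in> C" by (meson ex_in_conv)
  have "C \<noteq> {p}"
  proof
    assume "C = {p}"
    note single = this[unfolded C_def cells]
    have "fragile N D"
      unfolding fragile_def
      by (rule conjI[OF conn], rule exI[of _ D1], rule exI[of _ D2], intro conjI, (rule assms)+,
          rule exI[of _ p], rule single)
    with nonfragile show False by (rule notE)
  qed
  then obtain q where "q \<in> C" "p \<noteq> q" using p by (metis singletonD singletonI subsetI subset_antisym)
  with p have "p \<noteq> q \<and> {p, q} \<subseteq> C" by simp
  then show ?thesis unfolding C_def by (intro exI)
qed

text \<open>If every first-level cell missed \<open>U\<close> or \<open>V\<close>, the digits would
  split accordingly. A point common to both groups lies on neither side, so it is \<open>x\<close>,
  but there are two such points.\<close>

lemma ex_split_cell:
  assumes sep: "separates x U V"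
  shows "\<exists>i\<in>D. cell [i] \<inter> U \<noteq> {} \<and> cell [i] \<inter> V \<noteq> {} \<and> x \<in> cell [i]"
proof -
  have w1: "[a] \<in> W 1" if "a \<in> D" for a using that unfolding gsc_words_def by simp
  have meet: "\<exists>i\<in>D. cell [i] \<inter> S \<noteq> {}" if S: "S \<noteq> {}" "S \<subseteq> F" for S
  proof -
    obtain s where s: "s \<in> S" using S(1) by blast
    then obtain i where "i \<in> D" "s \<in> cell [i]" using ex_digit[of s] S(2) unfolding cell_single by blast
    with s show ?thesis by blast
  qed
  have UV: "U \<noteq> {}" "U \<subseteq> F" "V \<noteq> {}" "V \<subseteq> F" using sep unfolding separates_def by auto
  have "\<exists>i\<in>D. cell [i] \<inter> U \<noteq> {} \<and> cell [i] \<inter> V \<noteq> {}"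
  proof (rule ccontr)
    assume none: "\<not> (\<exists>i\<in>D. cell [i] \<inter> U \<noteq> {} \<and> cell [i] \<inter> V \<noteq> {})"
    define D1 where "D1 = {i \<in> D. cell [i] \<inter> V = {}}"
    obtain a where a: "a \<in> D" "cell [a] \<inter> U \<noteq> {}" using meet[OF UV(1,2)] by (elim bexE)
    obtain b where b: "b \<in> D" "cell [b] \<inter> V \<noteq> {}" using meet[OF UV(3,4)] by (elim bexE)
    have "a \<in> D1" using a none unfolding D1_def by blast
    moreover have "b \<in> D - D1" using b unfolding D1_def by simp
    moreover have "D1 \<inter> (D - D1) = {}" "D1 \<union> (D - D1) = D" unfolding D1_def by blast+
    ultimately obtain p q where pq: "p \<noteq> q" "{p, q} \<subseteq> (\<Union>i\<in>D1. cell [i]) \<inter> (\<Union>i\<in>D - D1. cell [i])"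
      using two_contacts[of D1 "D - D1"] by (metis empty_iff)
    have "r = x" if pqr: "r \<in> {p, q}" for r
    proof -
      have "r \<in> (\<Union>i\<in>D1. cell [i])" "r \<in> (\<Union>i\<in>D - D1. cell [i])" using pqr pq(2) by (rule subsetD[rotated, THEN IntD1], rule subsetD[rotated, THEN IntD2])
      then obtain i j where r: "r \<in> cell [i]" "r \<in> cell [j]" "i \<in> D1" "j \<in> D - D1" by (elim UN_E)
      have "r \<notin> V" using r(1,3) unfolding D1_def by blast
      moreover have "cell [j] \<inter> U = {}" using none r(4) unfolding D1_def by blast
      then have "r \<notin> U" using r(2) by blast
      moreover have "r \<in> F" using cell_subset_F[OF w1, of j] r by blast
      ultimately show ?thesis using sep unfolding separates_def by blast
    qed
    then have "p = x" "q = x" by blast+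
    then show False using pq(1) by simp
  qed
  then obtain i where i: "i \<in> D" "cell [i] \<inter> U \<noteq> {}" "cell [i] \<inter> V \<noteq> {}" by blast
  have "x \<in> cell [i]"
  proof (rule ccontr)
    assume "x \<notin> cell [i]"
    then have "cell [i] \<subseteq> U \<or> cell [i] \<subseteq> V"
      by (rule separates_connected[OF sep connected_cell cell_subset_F[OF w1[OF i(1)]]])
    with i separates_disjoint[OF sep] show False by blast
  qed
  with i show ?thesis by blast
qed

lemma ex_pull:
  assumes sep: "separates x U V"
  shows "\<exists>i\<in>D. \<exists>y\<in>F. x = \<phi> i y \<and> separates y (pull [i] U) (pull [i] V)"
proof -
  obtain i where i: "i \<in> D" "cell [i] \<inter> U \<noteq> {}" "cell [i] \<inter> V \<noteq> {}" "x \<in> cell [i]"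
    using ex_split_cell[OF sep] by blast
  obtain y where y: "y \<in> F" "x = \<Phi> [i] y" using i(4) by blast
  have "[i] \<in> W 1" using i(1) unfolding gsc_words_def by simp
  have "separates (\<Phi> [i] y) U V" using sep y(2) by simp
  from pull_separates[OF this \<open>[i] \<in> W 1\<close> y(1) i(2,3)] have "separates y (pull [i] U) (pull [i] V)" .
  moreover have "x = \<phi> i y" using y(2) by simp
  ultimately show ?thesis using i(1) y(1) by blast
qed

lemma ex_pull_word:
  "separates x U V \<Longrightarrow> \<exists>w\<in>W k. \<exists>y U' V'. x = \<Phi> w y \<and> separates y U' V'"
proof (induction k arbitrary: x U V)
  case 0
  then show ?case by (intro bexI[of _ "[]"]) auto
next
  case (Suc k)
  obtain i y where i: "i \<in> D" "x = \<phi> i y" "separates y (pull [i] U) (pull [i] V)"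
    using ex_pull[OF Suc.prems] by blast
  obtain w z U' V' where w: "w \<in> W k" "y = \<Phi> w z" "separates z U' V'" using Suc.IH[OF i(3)] by blast
  have "i # w \<in> W (Suc k)" "x = \<Phi> (i # w) z" using i w by simp_all
  with w(3) show ?case by blast
qed

text \<open>A point with several addresses lies on a grid line of some level, and its preimage in a cell of that
  level lies on the corresponding side of the unit square. Pulling back therefore increases the number of
  boundary coordinates, which is at most two.\<close>

lemma ex_uniquely_addressed:
  assumes "separates x U V"
  shows "\<exists>x U V. separates x U V \<and> uniquely_addressed x"
proof -
  define edges where "edges p = (if fst p = 0 \<or> fst p = 1 then 1 else 0) + (if snd p = 0 \<or> snd p = 1 then 1 else 0 :: nat)"
    for p :: "real \<times> real"
  show ?thesis using assms
  proof (induction "2 - edges x" arbitrary: x U V rule: less_induct)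
    case less
    show ?case
    proof (cases "uniquely_addressed x")
      case False
      then obtain k v w where vw: "v \<in> W k" "w \<in> W k" "x \<in> cell v" "x \<in> cell w" "v \<noteq> w"
        unfolding uniquely_addressed_def by blast
      obtain a where a: "a \<in> F" "x = \<Phi> v a" using vw(3) by blast
      obtain b where b: "b \<in> F" "x = \<Phi> w b" using vw(4) by blast
      \<comment> \<open>The word \<open>u\<close> of the pull-back need not be \<open>v\<close> or
        \<open>w\<close>, hence the third index in \<open>grid_boundary\<close>.\<close>
      obtain u y U' V' where u: "u \<in> W k" "x = \<Phi> u y" "separates y U' V'"
        using ex_pull_word[OF less.prems] by blast
      have y: "y \<in> F" using u(3) unfolding separates_def by blast
      have c: "real (N ^ k) * fst x = fst p + real (xval w)" "real (N ^ k) * snd x = snd p + real (yval w)"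
        if "w \<in> W k" "x = \<Phi> w p" for w p
        using Phi_coords[of w p] words_length[OF that(1)] that(2) by simp_all
      have un: "0 \<le> fst p" "fst p \<le> 1" "0 \<le> snd p" "snd p \<le> 1" if "p \<in> F" for p
        using unit_coords[OF that] by simp_all
      note ux = un(1,2)[OF a(1)] un(1,2)[OF b(1)] un(1,2)[OF y]
      note uy = un(3,4)[OF a(1)] un(3,4)[OF b(1)] un(3,4)[OF y]
      note gx = grid_boundary[OF c(1)[OF vw(1) a(2)] c(1)[OF vw(2) b(2)] c(1)[OF u(1,2)]
          word_val_less(1)[OF vw(1)] word_val_less(1)[OF vw(2)] word_val_less(1)[OF u(1)] ux]
      note gy = grid_boundary[OF c(2)[OF vw(1) a(2)] c(2)[OF vw(2) b(2)] c(2)[OF u(1,2)]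
          word_val_less(2)[OF vw(1)] word_val_less(2)[OF vw(2)] word_val_less(2)[OF u(1)] uy]
      define bx where "bx p \<longleftrightarrow> fst p = 0 \<or> fst p = 1" for p :: "real \<times> real"
      define yb where "yb p \<longleftrightarrow> snd p = 0 \<or> snd p = 1" for p :: "real \<times> real"
      have "bx x \<longrightarrow> bx y \<and> xval v = xval w" "xval v \<noteq> xval w \<longrightarrow> bx y"
        unfolding bx_def using gx by blast+
      moreover have "yb x \<longrightarrow> yb y \<and> yval v = yval w" "yval v \<noteq> yval w \<longrightarrow> yb y"
        unfolding yb_def using gy by blast+
      moreover have "xval v \<noteq> xval w \<or> yval v \<noteq> yval w" using word_eqI[OF vw(1,2)] vw(5) by blast
      \<comment> \<open>In a coordinate where the indices of \<open>v\<close> and \<open>w\<close>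
        differ, \<open>y\<close> is on the boundary and \<open>x\<close> is not; boundary
        coordinates of \<open>x\<close> persist.\<close>
      ultimately have "edges x < edges y" unfolding edges_def bx_def[symmetric] yb_def[symmetric] by auto
      moreover have "edges y \<le> 2" unfolding edges_def by simp
      ultimately have "2 - edges y < 2 - edges x" by linarith
      then show ?thesis by (rule less.hyps[OF _ u(3)])
    qed (use less.prems in blast)
  qed
qed

text \<open>One stage of pulling back along the address of \<open>x\<close>. The separation of
  \<open>y\<close> is the pulled-back one, so that the sides of consecutive stages can be
  compared.\<close>

definition config :: "real \<times> real \<Rightarrow> (real \<times> real) set \<Rightarrow> (real \<times> real) set \<Rightarrow> nat \<times> nat \<Rightarrow> real \<times> real \<Rightarrow> bool" where
  "config x U V i y \<longleftrightarrow> separates x U V \<and> uniquely_addressed x \<and> i \<in> D \<and> y \<in> F \<and> x = \<phi> i y \<and>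
     separates y (pull [i] U) (pull [i] V)"

lemma ex_config:
  assumes "separates x U V" "uniquely_addressed x"
  shows "\<exists>i y. config x U V i y"
  using ex_pull[OF assms(1)] assms unfolding config_def by blast

lemma config_sym: "config x U V i y \<Longrightarrow> config x V U i y"
  unfolding config_def using separates_sym[of x U V] separates_sym[of y "pull [i] U" "pull [i] V"] by blast

lemma config_next:
  assumes "config x U V i y"
  shows "\<exists>j z. config y (pull [i] U) (pull [i] V) j z"
proof (rule ex_config)
  have "[i] \<in> W 1" using assms unfolding config_def gsc_words_def by simp
  moreover have "uniquely_addressed x" "x = \<phi> i y" using assms unfolding config_def by blast+
  then have "uniquely_addressed (\<Phi> [i] y)" by simp
  ultimately show "uniquely_addressed y" using uniquely_addressed_pull by blast
qed (use assms in \<open>simp add: config_def\<close>)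

text \<open>If the other cells stay on side \<open>U\<close> at all stages, then \<open>V\<close>
  lies in the cell around \<open>x\<close> at every level, which is impossible as \<open>V\<close>
  has a point different from \<open>x\<close>.\<close>

lemma ex_switch:
  assumes bad: "\<forall>x U V i y. config x U V i y \<longrightarrow> all_others_in i U \<or> all_others_in i V"
    and start: "config x0 U0 V0 i0 y0"
  shows "\<exists>x U V i y j z. config x U V i y \<and> all_others_in i U \<and>
    config y (pull [i] U) (pull [i] V) j z \<and> all_others_in j (pull [i] V)"
proof (rule ccontr)
  assume no: "\<nexists>x U V i y j z. config x U V i y \<and> all_others_in i U \<and>
    config y (pull [i] U) (pull [i] V) j z \<and> all_others_in j (pull [i] V)"
  have shrink: "config x U V i y \<Longrightarrow> all_others_in i U \<Longrightarrow> \<exists>w\<in>W k. x \<in> cell w \<and> V \<subseteq> cell w" for k x U V i y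
  proof (induction k arbitrary: x U V i y)
    case 0
    then show ?case unfolding config_def separates_def by (intro bexI[of _ "[]"]) auto
  next
    case (Suc k)
    obtain j z where j: "config y (pull [i] U) (pull [i] V) j z" using config_next[OF Suc.prems(1)] by blast
    then have "all_others_in j (pull [i] U)" using bad[rule_format, OF j] no Suc.prems by blast
    then obtain w where w: "w \<in> W k" "y \<in> cell w" "pull [i] V \<subseteq> cell w" using Suc.IH[OF j] by blast
    have i: "i \<in> D" "x = \<Phi> [i] y" "U \<inter> V = {}" "V \<subseteq> F" using Suc.prems(1) unfolding config_def separates_def by auto
    have cw: "cell (i # w) = \<Phi> [i] ` cell w" using cell_append[of "[i]" w] by simp
    have "V \<subseteq> cell (i # w)"
    proof
      fix s assume s: "s \<in> V"
      then obtain a t where a: "a \<in> D" "t \<in> F" "s = \<phi> a t" using ex_digit[of s] i(4) by blast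
      have "s \<in> cell [a]" using a by simp
      then have "a = i" using Suc.prems(2) s i(3) a(1) unfolding all_others_in_def by blast
      then have "t \<in> pull [i] V" using a s unfolding pull_def by simp
      then show "s \<in> cell (i # w)" unfolding cw using w(3) a(3) \<open>a = i\<close> by auto
    qed
    moreover have "x \<in> cell (i # w)" unfolding cw i(2) using w(2) by blast
    moreover have "i # w \<in> W (Suc k)" using i(1) w(1) by simp
    ultimately show ?case by blast
  qed
  have False if c: "config x U V i y" "all_others_in i U" for x U V i y
  proof -
    obtain s where s: "s \<in> V" "s \<noteq> x" using c(1) unfolding config_def separates_def by blast
    obtain k where k: "2 / real N ^ k < dist s x" using small_cells[of "dist s x"] s(2) by auto
    obtain w where w: "w \<in> W k" "x \<in> cell w" "V \<subseteq> cell w" using shrink[OF c] by blast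
    then have "dist s x \<le> 2 / real N ^ k" using dist_cell[OF w(1)] s(1) by blast
    then show False using k by simp
  qed
  then show False using bad[rule_format, OF start] start config_sym[OF start] by blast
qed

section \<open>Translation into integer coordinates\<close>

abbreviation "digit_at a b \<equiv> 0 \<le> a \<and> 0 \<le> b \<and> (nat a, nat b) \<in> D"
abbreviation "point_at p q \<equiv> (p, q) \<in> F"
abbreviation "contact_at i p q \<equiv> contact digit_at point_at (int (fst i)) (int (snd i)) p q"
abbreviation "only_child_at j p q \<equiv> only_child (int N) digit_at point_at (int (fst j)) (int (snd j)) p q"

text \<open>The guards in \<open>digit_at\<close> exclude negative integers, which
  \<open>nat\<close> would send to 0.\<close>

lemma ex_digit_at: "(\<exists>a b. digit_at a b \<and> P a b) \<longleftrightarrow> (\<exists>d\<in>D. P (int (fst d)) (int (snd d)))"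
proof
  assume "\<exists>a b. digit_at a b \<and> P a b"
  then obtain a b where "digit_at a b" "P a b" by blast
  then show "\<exists>d\<in>D. P (int (fst d)) (int (snd d))" by (intro bexI[of _ "(nat a, nat b)"]) auto
next
  assume "\<exists>d\<in>D. P (int (fst d)) (int (snd d))"
  then obtain d where "d \<in> D" "P (int (fst d)) (int (snd d))" by blast
  then show "\<exists>a b. digit_at a b \<and> P a b" by (intro exI[of _ "int (fst d)"] exI[of _ "int (snd d)"]) auto
qed

lemma cell_single_iff:
  "(p, q) \<in> cell [a] \<longleftrightarrow> (real N * p - real (fst a), real N * q - real (snd a)) \<in> F"
proof -
  have "real N \<noteq> 0" using N2 by simp
  have "(p, q) = \<phi> a z \<longleftrightarrow> z = (real N * p - real (fst a), real N * q - real (snd a))" for z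
    using \<open>real N \<noteq> 0\<close> unfolding gsc_map_def by (cases z) (auto simp: field_simps)
  then show ?thesis unfolding cell_single by (simp add: image_iff)
qed

lemma phi_Pair: "\<phi> i (p, q) = ((p + real (fst i)) / real N, (q + real (snd i)) / real N)"
  unfolding gsc_map_def by simp

lemma only_child_at_iff: "only_child_at j p q \<longleftrightarrow> (\<forall>a\<in>D. (p, q) \<in> cell [a] \<longrightarrow> a = j)"
proof -
  have "\<not> only_child_at j p q \<longleftrightarrow> (\<exists>a b. digit_at a b \<and>
      (point_at (of_int (int N) * p - of_int a) (of_int (int N) * q - of_int b) \<and> \<not> (a = int (fst j) \<and> b = int (snd j))))"
    unfolding only_child_def by blast
  also have "\<dots> \<longleftrightarrow> (\<exists>a\<in>D. (p, q) \<in> cell [a] \<and> a \<noteq> j)"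
    unfolding ex_digit_at cell_single_iff by (auto simp: prod_eq_iff)
  finally show ?thesis by blast
qed

lemma contact_at_iff: "contact_at i p q \<longleftrightarrow> (p, q) \<in> F \<and> (\<exists>a\<in>D - {i}. \<phi> i (p, q) \<in> cell [a])"
proof -
  have "real N \<noteq> 0" using N2 by simp
  then have c: "\<phi> i (p, q) \<in> cell [a] \<longleftrightarrow> (p + real (fst i) - real (fst a), q + real (snd i) - real (snd a)) \<in> F" for a
    unfolding phi_Pair cell_single_iff by simp
  have ne: "(int (fst a), int (snd a)) \<noteq> (int (fst i), int (snd i)) \<longleftrightarrow> a \<noteq> i" for a
    by (simp add: prod_eq_iff)
  have "contact_at i p q \<longleftrightarrow> (p, q) \<in> F \<and> (\<exists>a\<in>D. (int (fst a), int (snd a)) \<noteq> (int (fst i), int (snd i)) \<and>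
      (p + real_of_int (int (fst i)) - real_of_int (int (fst a)), q + real_of_int (int (snd i)) - real_of_int (int (snd a))) \<in> F)"
    unfolding contact_def ex_digit_at ..
  then show ?thesis unfolding ne c of_int_of_nat_eq by blast
qed

lemma ex_two_contacts:
  assumes i: "i \<in> D"
  shows "\<exists>p q p' q'. contact_at i p q \<and> contact_at i p' q' \<and> (p, q) \<noteq> (p', q')"
proof -
  have "D - {i} \<noteq> {}"
  proof
    assume "D - {i} = {}"
    then have "card D \<le> card {i}" by (intro card_mono) auto
    then show False using card_D by simp
  qed
  then obtain s t where st: "s \<noteq> t" "{s, t} \<subseteq> (\<Union>a\<in>{i}. cell [a]) \<inter> (\<Union>a\<in>D - {i}. cell [a])"
    using two_contacts[of "{i}" "D - {i}"] i by blast
  have ex: "\<exists>p q. r = \<phi> i (p, q) \<and> contact_at i p q"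
    if r: "r \<in> cell [i]" "r \<in> (\<Union>a\<in>D - {i}. cell [a])" for r
  proof -
    obtain z where z: "z \<in> F" "r = \<phi> i z" using r(1) unfolding cell_single by blast
    then show ?thesis using r(2) unfolding contact_at_iff by (cases z) blast
  qed
  obtain p q where 1: "s = \<phi> i (p, q)" "contact_at i p q" using ex[of s] st(2) by blast
  obtain p' q' where 2: "t = \<phi> i (p', q')" "contact_at i p' q'" using ex[of t] st(2) by blast
  have "(p, q) \<noteq> (p', q')" using 1(1) 2(1) st(1) by metis
  with 1 2 show ?thesis by blast
qed

lemma contact_pull:
  assumes "all_others_in i U" "contact_at i p q"
  shows "(p, q) \<in> pull [i] U"
  using assms unfolding all_others_in_def contact_at_iff pull_def by auto

lemma only_child_if_other_side:
  assumes "all_others_in j V" "U \<inter> V = {}" "(p, q) \<in> U"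
  shows "only_child_at j p q"
  using assms unfolding all_others_in_def only_child_at_iff by blast

text \<open>The singleton of the fixed point is contained in the union of its own images, so the
  comparison of compact sets applies.\<close>

lemma fixed_point_in_F:
  assumes "i \<in> D"
  shows "(real (fst i) / (real N - 1), real (snd i) / (real N - 1)) \<in> F" (is "?p \<in> F")
proof -
  have "{?p} \<subseteq> (\<Union>a\<in>D. \<phi> a ` {?p})" using assms gsc_map_fixed[OF N2, of i] by (intro subsetI UN_I[of i]) auto
  moreover have "(\<Union>a\<in>D. \<phi> a ` F) \<subseteq> F" using phi_in_F by blast
  ultimately have "{?p} \<subseteq> F"
    by (intro invariant_compact_subset[OF N2 compact_F F_nonempty _ compact_sing])
  then show ?thesis by simp
qed

text \<open>Contacts of \<open>i\<close> pull back into side \<open>U\<close>, while at the next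
  stage all cells but \<open>j\<close> are on side \<open>V\<close>; so they lie only in
  \<open>j\<close>. If the cells other than \<open>l\<close> are then on side \<open>U\<close>, the
  same holds for contacts of \<open>j\<close> and the cell \<open>l\<close>; if they are on side
  \<open>V\<close>, for contacts of \<open>i\<close> pulled back to \<open>j\<close>. These are the
  two alternatives in \<open>alternation\<close>.\<close>

lemma no_switch:
  assumes c1: "config x U V i y" "all_others_in i U"
    and c2: "config y (pull [i] U) (pull [i] V) j z" "all_others_in j (pull [i] V)"
    and c3: "all_others_in l (pull [j] (pull [i] U)) \<or> all_others_in l (pull [j] (pull [i] V))"
  shows False
proof -
  have i: "i \<in> D" and j: "j \<in> D" using c1 c2 unfolding config_def by blast+
  have "U \<inter> V = {}" using c1 unfolding config_def separates_def by blast
  then have d1: "pull [i] U \<inter> pull [i] V = {}" by (rule pull_disjoint)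
  then have d2: "pull [j] (pull [i] U) \<inter> pull [j] (pull [i] V) = {}" by (rule pull_disjoint)
  have "alternation (int N) digit_at point_at (int (fst i)) (int (snd i)) (int (fst j)) (int (snd j))
    (int (fst l)) (int (snd l))"
  proof (unfold_locales, goal_cases)
    case 1
    show ?case using N2 by simp
  next
    case (2 a b)
    then show ?case using digits[of "(nat a, nat b)"] by auto
  next
    case (3 p q)
    then show ?case using unit_coords[of "(p, q)"] by simp
  next
    case (4 p q)
    have "(p, q) \<in> F \<longleftrightarrow> (\<exists>a\<in>D. (p, q) \<in> cell [a])"
    proof
      assume "(p, q) \<in> F"
      from ex_digit[OF this] show "\<exists>a\<in>D. (p, q) \<in> cell [a]" unfolding cell_single by blast
    next
      assume "\<exists>a\<in>D. (p, q) \<in> cell [a]"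
      then obtain a z where "a \<in> D" "z \<in> F" "(p, q) = \<phi> a z" unfolding cell_single by blast
      then show "(p, q) \<in> F" using phi_in_F[of a z] by simp
    qed
    also have "\<dots> \<longleftrightarrow> (\<exists>a b. digit_at a b \<and> point_at (of_int (int N) * p - of_int a) (of_int (int N) * q - of_int b))"
      unfolding ex_digit_at cell_single_iff by simp
    finally show ?case .
  next
    case (5 a b)
    then have "(real (nat a) / (real N - 1), real (nat b) / (real N - 1)) \<in> F"
      using fixed_point_in_F[of "(nat a, nat b)"] by simp
    with 5 show ?case by simp
  next
    case 6
    show ?case by (rule ex_two_contacts[OF i])
  next
    case 7
    show ?case by (rule ex_two_contacts[OF j])
  next
    case (8 p q)
    show ?case by (rule only_child_if_other_side[OF c2(2) d1 contact_pull[OF c1(2) 8]])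
  next
    case 9
    from c3 show ?case
    proof
      assume l: "all_others_in l (pull [j] (pull [i] U))"
      have "only_child_at l p q" if "contact_at j p q" for p q
        using only_child_if_other_side[OF l _ contact_pull[OF c2(2) that]] d2 by blast
      then show ?case by blast
    next
      assume l: "all_others_in l (pull [j] (pull [i] V))"
      have "only_child_at l p q"
        if "contact_at i ((p + of_int (int (fst j))) / of_int (int N)) ((q + of_int (int (snd j))) / of_int (int N))"
          "point_at p q" for p q
      proof (rule only_child_if_other_side[OF l d2])
        have "\<phi> j (p, q) \<in> pull [i] U" using contact_pull[OF c1(2) that(1)] unfolding phi_Pair by simp
        then show "(p, q) \<in> pull [j] (pull [i] U)" using that(2) unfolding pull_def[of "[j]"] by simp
      qed
      then show ?case by blast
    qed
  qed
  then show False by (rule alternation.inconsistent)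
qed

lemma chi_large_if_cut_point:
  assumes "has_cut_point F"
  shows "Gamma_chi N D (Suc k) \<ge> card D ^ k"
proof (rule ccontr)
  assume small: "\<not> Gamma_chi N D (Suc k) \<ge> card D ^ k"
  \<comment> \<open>Balanced configurations give the bound at every level, so its failure at a
    single level makes all configurations one-sided.\<close>
  have bad: "all_others_in i U \<or> all_others_in i V" if c: "config x U V i y" for x U V i y
  proof (rule ccontr)
    assume "\<not> (all_others_in i U \<or> all_others_in i V)"
    then have "Gamma_chi N D (Suc k) \<ge> card D ^ k"
      using c by (intro balanced_chi[of x U V i]) (auto simp: config_def)
    with small show False by simp
  qed
  obtain x U V where "separates x U V" "uniquely_addressed x"
    using separates_if_cut_point[OF assms] ex_uniquely_addressed by blast
  then obtain i y where "config x U V i y" using ex_config by blast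
  have "\<forall>x U V i y. config x U V i y \<longrightarrow> all_others_in i U \<or> all_others_in i V" using bad by blast
  from ex_switch[OF this \<open>config x U V i y\<close>] obtain x U V i y j z where
    c: "config x U V i y" "all_others_in i U" "config y (pull [i] U) (pull [i] V) j z" "all_others_in j (pull [i] V)"
    by blast
  obtain l t where l: "config z (pull [j] (pull [i] U)) (pull [j] (pull [i] V)) l t"
    using config_next[OF c(3)] by blast
  show False by (rule no_switch[OF c bad[OF l]])
qed

end

theorem mainTheorem4:
  fixes N :: nat and D :: "(nat \<times> nat) set"
  assumes "is_gsc N D"
    and "connected (gsc_attractor N D)"
    and "\<not> fragile N D"
  shows "(has_cut_point (gsc_attractor N D) \<longleftrightarrow>
            (\<forall>k\<ge>2. Gamma_chi N D k \<ge> card D ^ (k - 1)))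
         \<and> ((\<exists>k0\<ge>2. \<forall>k\<ge>k0. Gamma_chi N D k \<ge> card D ^ (k - 1))
              \<longrightarrow> has_cut_point (gsc_attractor N D))"
proof -
  interpret nonfragile_gsc N D by unfold_locales (rule assms)+
  have "Gamma_chi N D k \<ge> card D ^ (k - 1)" if "has_cut_point F" "k \<ge> 2" for k
    using chi_large_if_cut_point[OF that(1), of "k - 1"] that(2) by simp
  then show ?thesis using cut_point_if_chi_large by blast
qed

end
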